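(* Let $\Omega\subset\mathbb{R}^d$ be bounded, let $k$ be a continuous strictly positive definite kernel on $\Omega$ with $k(x,x)\le 1$ for all $x\in\Omega$, and assume that $k$ is well defined on the closure $\bar\Omega$ and that the extension $Ef\in\mathcal H_k(\bar\Omega)$ of any $f\in\mathcal H_k(\Omega)$ satisfies $\|Ef\|_{\mathcal H_k(\bar\Omega)}=\|f\|_{\mathcal H_k(\Omega)}$. Let $\Phi(\Omega):=\{k(\cdot,x):x\in\Omega\}\subset\mathcal H_k(\Omega)$ and $\varepsilon_n:=\varepsilon_n(\mathrm{co}(\Phi(\Omega)),\mathcal H_k(\Omega))$. Then for any $\beta\in[0,\infty]$, any admissible $\gamma\in(0,1]$ and any $f\in\mathcal H_k(\Omega)$, any weak $\beta$-greedy algorithm with parameter $\gamma$ applied to $f$ satisfies $$\min_{n+1\le i\le 2n}\|f-I_{X_i}f\|_{L_\infty(\Omega)}\le \gamma^{-1}\left(\sqrt5\, n^{\frac{1-\beta}{2}}\varepsilon_n\right)^{\frac{1}{\max(1,\beta)}}\|f-I_{X_{n+1}}f\|_{\mathcal H_k(\Omega)},\qquad n\in\mathbb N,\ n\ge1,$$ where for $\beta=\infty$ the factor $\left(\sqrt5\, n^{\frac{1-\beta}{2}}\varepsilon_n\right)^{1/\max(1,\beta)}$ is read as its limit $n^{-1/2}$.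
   Context: Kernel interpolation. $k$ is a real-valued kernel and $\mathcal H_k(\Omega)$ is its Reproducing Kernel Hilbert Space on $\Omega$. For a finite set $X\subset\Omega$ of pairwise distinct points, $V(X):=\mathrm{span}\{k(\cdot,x):x\in X\}$ and $I_Xf\in V(X)$ is the unique function in $V(X)$ that interpolates $f$ at $X$ (for $f\in\mathcal H_k(\Omega)$ it is the orthogonal projection of $f$ onto $V(X)$; $I_\emptyset f=0$). The power function is $P_X(x):=\|k(\cdot,x)-\Pi_{V(X)}k(\cdot,x)\|_{\mathcal H_k(\Omega)}$, with $\Pi_V$ the orthogonal projection onto $V$. "$k$ is well defined on $\bar\Omega$" means that $k$ can be evaluated on $\bar\Omega$ and is continuous and strictly positive definite there. Weak $\beta$-greedy algorithm. Let $X_0:=\emptyset$, $X_{n+1}:=X_n\cup\{x_{n+1}\}$. For $\beta\in[0,\infty)$ put $\eta_\beta(f,X_n)(x):=|(f-I_{X_n}f)(x)|^\beta P_{X_n}(x)^{1-\beta}$, and $\eta_\infty(f,X_n)(x):=|(f-I_{X_n}f)(x)|/P_{X_n}(x)$. A weak $\beta$-greedy algorithm with parameter $\gamma$ applied to $f$ produces any sequence of points such that for all $n\ge0$, $x_{n+1}\in\Omega\setminus X_n$ and $\eta_\beta(f,X_n)(x_{n+1})\ge\gamma\sup_{z\in\Omega\setminus X_n}\eta_\beta(f,X_n)(z)$. Admissible $\gamma$ means $\gamma\in(0,1)$ if $\Omega$ is open and $\gamma\in(0,1]$ if $\Omega$ is closed. Entropy numbers. For a subset $K$ of a Hilbert space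 $\mathcal H$: $\mathrm{co}(K):=\mathrm{clos}_{\mathcal H}\{\sum_i c_ig_i: g_i\in K,\ \sum_i|c_i|\le1\}$ (finite sums), and $\varepsilon_n(K,\mathcal H)$ is the infimum of all $\varepsilon>0$ such that $K$ can be covered by at most $2^n$ balls of radius $\varepsilon$ with centers in $\mathcal H$. *)

theory Defs
  imports "HOL-Analysis.Analysis"
begin

section \<open>Hilbert spaces of real functions\<close>

text \<open>
  A function on \<open>S\<close> is represented by its extension by zero to the whole type, so that equality
  of elements is equality of functions on \<open>S\<close>. The inner product is only meaningful on the
  carrier \<open>funs H\<close>; this is why the distance below is set to 0 off the carrier, as the library's
  abstract metric spaces require a distance that is nonnegative and symmetric on the whole type.
\<close>

record 'a fun_space =
  funs :: "('a \<Rightarrow> real) set"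
  ip :: "('a \<Rightarrow> real) \<Rightarrow> ('a \<Rightarrow> real) \<Rightarrow> real"

definition hnorm :: "'a fun_space \<Rightarrow> ('a \<Rightarrow> real) \<Rightarrow> real" where
  "hnorm H f = sqrt (ip H f f)"

definition hdist :: "'a fun_space \<Rightarrow> ('a \<Rightarrow> real) \<Rightarrow> ('a \<Rightarrow> real) \<Rightarrow> real" where
  "hdist H f g = (if f \<in> funs H \<and> g \<in> funs H then hnorm H (f - g) else 0)"

definition inner_fun_space :: "'a set \<Rightarrow> 'a fun_space \<Rightarrow> bool" where
  "inner_fun_space S H \<longleftrightarrow>
     (\<forall>f\<in>funs H. \<forall>x. x \<notin> S \<longrightarrow> f x = 0) \<and>
     (\<lambda>x. 0) \<in> funs H \<and>
     (\<forall>f\<in>funs H. \<forall>g\<in>funs H. (\<lambda>x. f x + g x) \<in> funs H) \<and>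
     (\<forall>f\<in>funs H. \<forall>c. (\<lambda>x. c * f x) \<in> funs H) \<and>
     (\<forall>f\<in>funs H. \<forall>g\<in>funs H. ip H f g = ip H g f) \<and>
     (\<forall>f\<in>funs H. \<forall>g\<in>funs H. \<forall>h\<in>funs H. ip H (\<lambda>x. f x + g x) h = ip H f h + ip H g h) \<and>
     (\<forall>f\<in>funs H. \<forall>g\<in>funs H. \<forall>c. ip H (\<lambda>x. c * f x) g = c * ip H f g) \<and>
     (\<forall>f\<in>funs H. f \<noteq> (\<lambda>x. 0) \<longrightarrow> ip H f f > 0)"

lemma inner_fun_space_cauchy_schwarz:
  assumes "inner_fun_space S H" "f \<in> funs H" "g \<in> funs H"
  shows "(ip H f g)^2 \<le> ip H f f * ip H g g"
proof (cases "g = (\<lambda>x. 0)")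
  case True
  have z: "(\<lambda>x. 0 * f x) = (\<lambda>x. 0)" by simp
  have "ip H (\<lambda>x. 0 * f x) f = 0 * ip H f f" using assms unfolding inner_fun_space_def by blast
  hence "ip H g f = 0" using True z by simp
  hence "ip H f g = 0" using assms unfolding inner_fun_space_def by metis
  moreover have "ip H (\<lambda>x. 0 * f x) g = 0 * ip H f g" using assms unfolding inner_fun_space_def by blast
  ultimately show ?thesis using True z by simp
next
  case False
  have pos: "ip H g g > 0" using assms False unfolding inner_fun_space_def by blast
  define c where "c = - ip H f g / ip H g g"
  define h where "h = (\<lambda>x. f x + c * g x)"
  have cg: "(\<lambda>x. c * g x) \<in> funs H" using assms unfolding inner_fun_space_def by blast
  have addH: "\<And>u v. u \<in> funs H \<Longrightarrow> v \<in> funs H \<Longrightarrow> (\<lambda>x. u x + v x) \<in> funs H"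
   using assms(1) unfolding inner_fun_space_def by blast
  have iaH: "\<And>u v w. u \<in> funs H \<Longrightarrow> v \<in> funs H \<Longrightarrow> w \<in> funs H \<Longrightarrow> ip H (\<lambda>x. u x + v x) w = ip H u w + ip H v w"
   using assms(1) unfolding inner_fun_space_def by blast
  have h: "h \<in> funs H" unfolding h_def using addH[OF assms(2) cg] .
  have a: "ip H h u = ip H f u + c * ip H g u" if "u \<in> funs H" for u
  proof -
    have "ip H h u = ip H f u + ip H (\<lambda>x. c * g x) u"
      unfolding h_def using iaH[OF assms(2) cg that] .
    moreover have "ip H (\<lambda>x. c * g x) u = c * ip H g u" using assms that unfolding inner_fun_space_def by blast
    ultimately show ?thesis by simp
  qed
  have s: "ip H u v = ip H v u" if "u \<in> funs H" "v \<in> funs H" for u v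
    using assms that unfolding inner_fun_space_def by blast
  have "ip H h h \<ge> 0"
  proof (cases "h = (\<lambda>x. 0)")
    case True
    have "ip H (\<lambda>x. 0 * h x) h = 0 * ip H h h" using assms h unfolding inner_fun_space_def by blast
    thus ?thesis using True by simp
  next
    case False thus ?thesis using assms h unfolding inner_fun_space_def by (metis less_imp_le)
  qed
  also have "ip H h h = ip H f f + 2 * c * ip H f g + c^2 * ip H g g"
    using a[OF h] a[OF assms(2)] a[OF assms(3)] s[OF h assms(2)] s[OF h assms(3)] s[OF assms(2,3)]
    by (simp add: algebra_simps power2_eq_square)
  also have "\<dots> = ip H f f - (ip H f g)^2 / ip H g g"
    using pos unfolding c_def by (simp add: field_simps power2_eq_square)
  finally show ?thesis using pos by (simp add: field_simps)
qed

lemma Metric_space_hdist: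
  assumes I: "inner_fun_space S H"
  shows "Metric_space (funs H) (hdist H)"
proof -
  have add: "f \<in> funs H \<Longrightarrow> g \<in> funs H \<Longrightarrow> (\<lambda>x. f x + g x) \<in> funs H" for f g
    using I unfolding inner_fun_space_def by blast
  have sc: "f \<in> funs H \<Longrightarrow> (\<lambda>x. c * f x) \<in> funs H" for f c
    using I unfolding inner_fun_space_def by blast
  have ia: "f \<in> funs H \<Longrightarrow> g \<in> funs H \<Longrightarrow> h \<in> funs H \<Longrightarrow> ip H (\<lambda>x. f x + g x) h = ip H f h + ip H g h" for f g h
    using I unfolding inner_fun_space_def by blast
  have isc: "f \<in> funs H \<Longrightarrow> g \<in> funs H \<Longrightarrow> ip H (\<lambda>x. c * f x) g = c * ip H f g" for f g c
    using I unfolding inner_fun_space_def by blast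
  have sy: "f \<in> funs H \<Longrightarrow> g \<in> funs H \<Longrightarrow> ip H f g = ip H g f" for f g
    using I unfolding inner_fun_space_def by blast
  have diff: "f - g \<in> funs H" if "f \<in> funs H" "g \<in> funs H" for f g
    using add[OF that(1) sc[OF that(2), of "-1"]] by (simp add: fun_diff_def)
  have z0: "ip H (\<lambda>x. 0) (\<lambda>x. 0) = 0"
    using isc[of "\<lambda>x. 0" "\<lambda>x. 0" 0] I unfolding inner_fun_space_def by auto
  have pos: "f \<in> funs H \<Longrightarrow> ip H f f \<ge> 0 \<and> (ip H f f = 0 \<longleftrightarrow> f = (\<lambda>x. 0))" for f
    using z0 I unfolding inner_fun_space_def by (metis less_irrefl less_imp_le order_refl)
  have tri: "hnorm H (\<lambda>x. u x + v x) \<le> hnorm H u + hnorm H v" if u: "u \<in> funs H" and v: "v \<in> funs H" for u v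
  proof -
    have "ip H (\<lambda>x. u x + v x) (\<lambda>x. u x + v x) = ip H u u + 2 * ip H u v + ip H v v"
      using ia[OF u v add[OF u v]] sy[OF u add[OF u v]] sy[OF v add[OF u v]] ia[OF u v u] ia[OF u v v] sy[OF u v] by simp
    moreover have "ip H u v \<le> sqrt (ip H u u) * sqrt (ip H v v)"
      using inner_fun_space_cauchy_schwarz[OF I u v] by (metis real_le_rsqrt real_sqrt_mult)
    ultimately show ?thesis unfolding hnorm_def using pos[OF u] pos[OF v]
      by (intro real_le_lsqrt) (auto simp: power2_eq_square algebra_simps)
  qed
  show ?thesis
  proof
    fix f g show "0 \<le> hdist H f g" using pos diff by (auto simp: hdist_def hnorm_def)
    show "hdist H f g = hdist H g f"
    proof (cases "f \<in> funs H \<and> g \<in> funs H")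
      case True
      hence d: "g - f \<in> funs H" "f - g \<in> funs H" using diff by auto
      have e: "f - g = (\<lambda>x. -1 * (g - f) x)" by (auto simp: fun_diff_def)
      have "ip H (f - g) (f - g) = ip H (g - f) (g - f)"
        using isc[OF d(1) d(2), of "-1"] isc[OF d(1) d(1), of "-1"] sy[OF d] e by (metis minus_minus mult_minus1)
      thus ?thesis by (simp add: hdist_def hnorm_def)
    qed (auto simp: hdist_def)
  next
    fix f g assume "f \<in> funs H" "g \<in> funs H"
    thus "hdist H f g = 0 \<longleftrightarrow> f = g" using pos[OF diff[of f g]] by (auto simp: hdist_def hnorm_def fun_eq_iff)
  next
    fix f g h assume *: "f \<in> funs H" "g \<in> funs H" "h \<in> funs H"
    have "f - h = (\<lambda>x. (f - g) x + (g - h) x)" by auto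
    thus "hdist H f h \<le> hdist H f g + hdist H g h"
      using tri[OF diff[of f g] diff[of g h]] * by (simp add: hdist_def)
  qed
qed

definition hilbert_fun_space :: "'a set \<Rightarrow> 'a fun_space \<Rightarrow> bool" where
  "hilbert_fun_space S H \<longleftrightarrow>
     inner_fun_space S H \<and> Metric_space.mcomplete (funs H) (hdist H)"

text \<open>Orthogonal projection of \<open>f\<close> onto the subspace \<open>V\<close>.\<close>

definition hproj :: "'a fun_space \<Rightarrow> ('a \<Rightarrow> real) set \<Rightarrow> ('a \<Rightarrow> real) \<Rightarrow> ('a \<Rightarrow> real)" where
  "hproj H V f = (THE g. g \<in> V \<and> (\<forall>v\<in>V. ip H (f - g) v = 0))"


section \<open>Kernels and their reproducing kernel Hilbert spaces\<close>

definition strictly_pos_def_on :: "'a set \<Rightarrow> ('a \<Rightarrow> 'a \<Rightarrow> real) \<Rightarrow> bool" where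
  "strictly_pos_def_on S k \<longleftrightarrow>
     (\<forall>x\<in>S. \<forall>y\<in>S. k x y = k y x) \<and>
     (\<forall>X c. finite X \<longrightarrow> X \<subseteq> S \<longrightarrow> (\<exists>x\<in>X. c x \<noteq> 0) \<longrightarrow>
        (\<Sum>x\<in>X. \<Sum>y\<in>X. c x * c y * k x y) > 0)"

definition cont_spd_kernel :: "'a::topological_space set \<Rightarrow> ('a \<Rightarrow> 'a \<Rightarrow> real) \<Rightarrow> bool" where
  "cont_spd_kernel S k \<longleftrightarrow>
     continuous_on (S \<times> S) (\<lambda>(x, y). k x y) \<and> strictly_pos_def_on S k"

text \<open>The element \<open>k(\<cdot>, x)\<close> as a function on \<open>S\<close>.\<close>

definition ksec :: "'a set \<Rightarrow> ('a \<Rightarrow> 'a \<Rightarrow> real) \<Rightarrow> 'a \<Rightarrow> ('a \<Rightarrow> real)" where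
  "ksec S k x = (\<lambda>y. if y \<in> S then k y x else 0)"

text \<open>By the Moore--Aronszajn theorem, for a positive definite \<open>k\<close> such a space exists, and its
  functions and its inner product on them are uniquely determined.\<close>

definition is_rkhs :: "'a set \<Rightarrow> ('a \<Rightarrow> 'a \<Rightarrow> real) \<Rightarrow> 'a fun_space \<Rightarrow> bool" where
  "is_rkhs S k H \<longleftrightarrow>
     hilbert_fun_space S H \<and>
     (\<forall>x\<in>S. ksec S k x \<in> funs H) \<and>
     (\<forall>f\<in>funs H. \<forall>x\<in>S. f x = ip H f (ksec S k x))"


section \<open>Kernel interpolation and the power function\<close>

definition kspan :: "'a set \<Rightarrow> ('a \<Rightarrow> 'a \<Rightarrow> real) \<Rightarrow> 'a set \<Rightarrow> ('a \<Rightarrow> real) set" where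
  "kspan S k X = {(\<lambda>y. \<Sum>x\<in>X. c x * ksec S k x y) | c. True}"

definition interpolant ::
  "'a set \<Rightarrow> ('a \<Rightarrow> 'a \<Rightarrow> real) \<Rightarrow> 'a set \<Rightarrow> ('a \<Rightarrow> real) \<Rightarrow> ('a \<Rightarrow> real)" where
  "interpolant S k X f = (THE g. g \<in> kspan S k X \<and> (\<forall>x\<in>X. g x = f x))"

definition power_fun ::
  "'a set \<Rightarrow> ('a \<Rightarrow> 'a \<Rightarrow> real) \<Rightarrow> 'a fun_space \<Rightarrow> 'a set \<Rightarrow> 'a \<Rightarrow> real" where
  "power_fun S k H X x = hnorm H (ksec S k x - hproj H (kspan S k X) (ksec S k x))"

definition sup_norm :: "'a set \<Rightarrow> ('a \<Rightarrow> real) \<Rightarrow> real" where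
  "sup_norm S g = (SUP x\<in>S. \<bar>g x\<bar>)"


section \<open>Weak \<open>\<beta>\<close>-greedy algorithms\<close>

text \<open>Real powers with the convention \<open>0\<^sup>0 = 1\<close>; the library has \<open>0 powr 0 = 0\<close>. The convention
  matters for \<open>\<beta> = 0\<close>, where the selection criterion is to be the power function.\<close>

definition rpow :: "real \<Rightarrow> real \<Rightarrow> real" where
  "rpow t a = (if a = 0 then 1 else t powr a)"

definition eta ::
  "'a set \<Rightarrow> ('a \<Rightarrow> 'a \<Rightarrow> real) \<Rightarrow> 'a fun_space \<Rightarrow> ennreal \<Rightarrow> ('a \<Rightarrow> real) \<Rightarrow> 'a set \<Rightarrow> 'a \<Rightarrow> real" where
  "eta S k H \<beta> f X x =
     (if \<beta> = \<infinity> then \<bar>(f - interpolant S k X f) x\<bar> / power_fun S k H X x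
      else rpow \<bar>(f - interpolant S k X f) x\<bar> (enn2real \<beta>)
             * rpow (power_fun S k H X x) (1 - enn2real \<beta>))"

text \<open>The selected points are \<open>x 1, x 2, \<dots>\<close>; the value \<open>x 0\<close> is not used.\<close>

definition sel :: "(nat \<Rightarrow> 'a) \<Rightarrow> nat \<Rightarrow> 'a set" where
  "sel x n = x ` {1..n}"

text \<open>The supremum below is over a set that is bounded above: \<open>|f - I\<^sub>X f|\<close> is at most \<open>P\<^sub>X\<close> times
  the norm of \<open>f - I\<^sub>X f\<close>, and \<open>P\<^sub>X\<close> is positive off \<open>X\<close> and bounded if \<open>k\<close> is bounded on
  the diagonal.\<close>

definition weak_greedy ::
  "'a set \<Rightarrow> ('a \<Rightarrow> 'a \<Rightarrow> real) \<Rightarrow> 'a fun_space \<Rightarrow> ennreal \<Rightarrow> real \<Rightarrow> ('a \<Rightarrow> real) \<Rightarrow> (nat \<Rightarrow> 'a) \<Rightarrow> bool" where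
  "weak_greedy S k H \<beta> \<gamma> f x \<longleftrightarrow>
     (\<forall>n. x (n + 1) \<in> S - sel x n \<and>
          eta S k H \<beta> f (sel x n) (x (n + 1))
            \<ge> \<gamma> * (SUP z\<in>S - sel x n. eta S k H \<beta> f (sel x n) z))"

text \<open>The value \<open>\<gamma> = 1\<close> is excluded for open sets only.\<close>

definition admissible :: "'a::topological_space set \<Rightarrow> real \<Rightarrow> bool" where
  "admissible S \<gamma> \<longleftrightarrow> 0 < \<gamma> \<and> \<gamma> \<le> 1 \<and> (open S \<longrightarrow> \<gamma> < 1)"


section \<open>Entropy numbers\<close>

definition abs_conv_hull :: "'a fun_space \<Rightarrow> ('a \<Rightarrow> real) set \<Rightarrow> ('a \<Rightarrow> real) set" where
  "abs_conv_hull H K =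
     Metric_space.mtopology (funs H) (hdist H) closure_of
       {(\<lambda>y. \<Sum>i<m. c i * g i y) | (m::nat) c g. (\<forall>i<m. g i \<in> K) \<and> (\<Sum>i<m. \<bar>c i\<bar>) \<le> 1}"

definition entropy_number :: "'a fun_space \<Rightarrow> ('a \<Rightarrow> real) set \<Rightarrow> nat \<Rightarrow> real" where
  "entropy_number H K n =
     Inf {e. 0 < e \<and> (\<exists>C. C \<subseteq> funs H \<and> finite C \<and> card C \<le> 2 ^ n \<and>
                           K \<subseteq> (\<Union>c\<in>C. Metric_space.mcball (funs H) (hdist H) c e))}"

text \<open>The case \<open>\<beta> = \<infinity>\<close> is the limit of the other one as \<open>\<beta> \<rightarrow> \<infinity>\<close> (for \<open>e > 0\<close>).\<close>

definition rate_factor :: "ennreal \<Rightarrow> nat \<Rightarrow> real \<Rightarrow> real" where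
  "rate_factor \<beta> n e =
     (if \<beta> = \<infinity> then real n powr (- 1 / 2)
      else (sqrt 5 * real n powr ((1 - enn2real \<beta>) / 2) * e) powr (1 / max 1 (enn2real \<beta>)))"

end

theory Submission
  imports Defs
begin

text \<open>
  Write \<open>r\<^sub>i = f - I\<^sub>X\<^sub>i f\<close> and \<open>p\<^sub>i = P\<^sub>X\<^sub>i(x\<^sub>i\<^sub>+\<^sub>1)\<close>, and let \<open>v\<^sub>i\<close> be the Newton basis, the Gram--Schmidt
  orthonormalisation of the sections \<open>k(\<cdot>, x\<^sub>i\<^sub>+\<^sub>1)\<close>. The coefficient of \<open>r\<^sub>n\<^sub>+\<^sub>1\<close> along \<open>v\<^sub>i\<close> is
  \<open>r\<^sub>i(x\<^sub>i\<^sub>+\<^sub>1) / p\<^sub>i\<close>, so Bessel's inequality and AM--GM over \<open>n + 1 \<le> i \<le> 2n\<close> bound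
  \<open>\<Prod> |r\<^sub>i(x\<^sub>i\<^sub>+\<^sub>1)| / p\<^sub>i\<close> by \<open>(n\<^sup>-\<^sup>1\<^sup>/\<^sup>2 \<parallel>r\<^sub>n\<^sub>+\<^sub>1\<parallel>)\<^sup>n\<close>. In the Newton basis the sections have a triangular
  coefficient matrix with diagonal \<open>p\<^sub>i\<close>. A cover of the absolutely convex hull by \<open>2\<^sup>n\<close> balls of radius
  \<open>\<epsilon>\<close>, pulled back to coefficient space, covers the cross-polytope of volume \<open>2\<^sup>n / n!\<close> by ellipsoids
  of volume at most \<open>V\<^sub>n \<epsilon>\<^sup>n / \<Prod> p\<^sub>i\<close>, where \<open>V\<^sub>n\<close> is the volume of the unit ball; hence
  \<open>\<Prod> p\<^sub>i \<le> n! V\<^sub>n \<epsilon>\<^sup>n \<le> (\<surd>(5n) \<epsilon>)\<^sup>n\<close>. The greedy selection bounds the sup norm of \<open>r\<^sub>i\<close> by a product of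
  powers of \<open>|r\<^sub>i(x\<^sub>i\<^sub>+\<^sub>1)| / p\<^sub>i\<close>, \<open>p\<^sub>i\<close> and \<open>\<parallel>r\<^sub>n\<^sub>+\<^sub>1\<parallel>\<close>, and the minimum over \<open>i\<close> is at most the geometric
  mean of these bounds.
\<close>

section \<open>Volumes and coverings\<close>

text \<open>Induction adds the largest index \<open>b\<close>. Triangularity makes coordinate
  \<open>b\<close> of the image depend on \<open>c b\<close> alone, while \<open>c b\<close> acts on
  the other coordinates only as a translation. Hence the induction hypothesis integrates out
  \<open>A\<close> for fixed \<open>c b\<close>, and a one-dimensional affine substitution does the
  rest. The translation \<open>y\<close> and the integrand \<open>F\<close> both change on the way,
  so both are general.\<close>

lemma nn_integral_PiM_triangular:
  fixes a :: "nat \<Rightarrow> nat \<Rightarrow> real" and F :: "(nat \<Rightarrow> real) \<Rightarrow> ennreal"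
  assumes "finite A" "\<And>i. i \<in> A \<Longrightarrow> a i i > 0"
    and "\<And>i j. i \<in> A \<Longrightarrow> j \<in> A \<Longrightarrow> i < j \<Longrightarrow> a i j = 0"
    and "F \<in> borel_measurable (Pi\<^sub>M A (\<lambda>_. lborel))"
  shows "ennreal (\<Prod>i\<in>A. a i i) * (\<integral>\<^sup>+ c. F (\<lambda>j\<in>A. (\<Sum>i\<in>A. c i * a i j) - y j) \<partial>Pi\<^sub>M A (\<lambda>_. lborel))
       = (\<integral>\<^sup>+ c. F c \<partial>Pi\<^sub>M A (\<lambda>_. lborel))"
  using assms
proof (induction A arbitrary: F y rule: finite_linorder_max_induct)
  case empty
  interpret product_sigma_finite "\<lambda>_. lborel" by standard
  show ?case by (simp add: PiM_empty nn_integral_count_space_finite restrict_def)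
next
  case (insert b A)
  interpret product_sigma_finite "\<lambda>_. lborel" by standard
  have b: "b \<notin> A" using insert.hyps by auto
  note [measurable] = insert.prems(3)
  note [simp] = \<open>finite A\<close>
  let ?M = "\<lambda>A. Pi\<^sub>M A (\<lambda>_. lborel) :: (nat \<Rightarrow> real) measure"
  define T where "T = (\<lambda>y c. \<lambda>j\<in>insert b A. (\<Sum>i\<in>insert b A. c i * a i j) - y j)"
  define T' where "T' = (\<lambda>y c. \<lambda>j\<in>A. (\<Sum>i\<in>A. c i * a i j) - y j)"
  \<comment> \<open>Setting coordinate \<open>b\<close> to \<open>t\<close> leaves the map for
    \<open>A\<close> with \<open>y\<close> shifted by \<open>t\<close> times row \<open>b\<close> of
    the matrix.\<close>
  have T_upd: "T y (c(b := t)) = (T' (\<lambda>j. y j - t * a b j) c)(b := - y b + a b b * t)" for c t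
  proof
    fix j
    have 1: "(\<Sum>i\<in>A. (if i = b then t else c i) * a i j) = (\<Sum>i\<in>A. c i * a i j)"
      using b by (intro sum.cong) auto
    have 2: "(\<Sum>i\<in>A. (if i = b then t else c i) * a i b) = 0"
      using insert by (intro sum.neutral) auto
    show "T y (c(b := t)) j = ((T' (\<lambda>j. y j - t * a b j) c)(b := - y b + a b b * t)) j"
      using b by (auto simp: T_def T'_def 1 2 fun_upd_def right_diff_distrib)
  qed
  have T[measurable]: "T y \<in> ?M (insert b A) \<rightarrow>\<^sub>M ?M (insert b A)" for y
    unfolding T_def by measurable
  \<comment> \<open>\<open>G s\<close> is the integral of \<open>F\<close> over the slice on which
    coordinate \<open>b\<close> equals \<open>s\<close>.\<close>
  define G where "G = (\<lambda>s. \<integral>\<^sup>+ u. F (u(b := s)) \<partial>?M A)"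
  have G[measurable]: "G \<in> borel_measurable borel"
  proof -
    interpret A: sigma_finite_measure "?M A"
      by (rule sigma_finite) simp
    have "(\<lambda>(s, u). F (u(b := s))) \<in> borel_measurable (borel \<Otimes>\<^sub>M ?M A)"
      by measurable
    then show ?thesis unfolding G_def by (rule A.borel_measurable_nn_integral)
  qed
  have FT: "(\<lambda>c. F (T y c)) \<in> borel_measurable (?M (insert b A))" by measurable
  have upd: "(\<lambda>u. F (u(b := s))) \<in> borel_measurable (?M A)" for s
  proof -
    have "(\<lambda>u. u(b := s)) \<in> ?M A \<rightarrow>\<^sub>M ?M (insert b A)" by measurable
    from measurable_compose[OF this insert.prems(3)] show ?thesis .
  qed
  have IH: "ennreal (\<Prod>i\<in>A. a i i) * (\<integral>\<^sup>+ c. F ((T' y c)(b := s)) \<partial>?M A) = G s" for y s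
    unfolding T'_def G_def using insert.prems(1,2) by (intro insert.IH upd) auto
  have "(\<integral>\<^sup>+ c. F (T y c) \<partial>?M (insert b A)) = (\<integral>\<^sup>+ t. \<integral>\<^sup>+ c. F (T y (c(b := t))) \<partial>?M A \<partial>lborel)"
    using b FT by (intro product_nn_integral_insert_rev) auto
  also have "ennreal (\<Prod>i\<in>A. a i i) * \<dots> =
      (\<integral>\<^sup>+ t. ennreal (\<Prod>i\<in>A. a i i) * (\<integral>\<^sup>+ c. F (T y (c(b := t))) \<partial>?M A) \<partial>lborel)"
  proof (rule nn_integral_cmult[symmetric])
    interpret A: sigma_finite_measure "?M A"
      by (rule sigma_finite) simp
    have "(\<lambda>(t, c). F (T y (c(b := t)))) \<in> borel_measurable (borel \<Otimes>\<^sub>M ?M A)"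
      using FT by measurable
    from A.borel_measurable_nn_integral[OF this]
    show "(\<lambda>t. \<integral>\<^sup>+ c. F (T y (c(b := t))) \<partial>?M A) \<in> borel_measurable lborel" by simp
  qed
  also have "\<dots> = (\<integral>\<^sup>+ t. G (- y b + a b b * t) \<partial>lborel)"
    by (simp add: T_upd IH)
  finally have *: "ennreal (\<Prod>i\<in>A. a i i) * (\<integral>\<^sup>+ c. F (T y c) \<partial>?M (insert b A)) =
      (\<integral>\<^sup>+ t. G (- y b + a b b * t) \<partial>lborel)" .
  have "ennreal (a b b) * (\<integral>\<^sup>+ t. G (- y b + a b b * t) \<partial>lborel) = (\<integral>\<^sup>+ t. G t \<partial>lborel)"
    using insert.prems(1)[of b] nn_integral_real_affine[OF G, of "a b b" "- y b"] by simp
  also have "\<dots> = (\<integral>\<^sup>+ c. F c \<partial>?M (insert b A))"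
    unfolding G_def using b insert.prems(3) by (intro product_nn_integral_insert_rev[symmetric]) auto
  finally have "ennreal (a b b) * (ennreal (\<Prod>i\<in>A. a i i) * (\<integral>\<^sup>+ c. F (T y c) \<partial>?M (insert b A))) =
      (\<integral>\<^sup>+ c. F c \<partial>?M (insert b A))" by (simp add: *)
  moreover have "ennreal (\<Prod>i\<in>insert b A. a i i) = ennreal (a b b) * ennreal (\<Prod>i\<in>A. a i i)"
    using b insert.prems(1) by (simp add: ennreal_mult prod_nonneg less_imp_le)
  ultimately show ?case by (simp only: T_def mult.assoc)
qed

section \<open>The volume of the cross-polytope\<close>

text \<open>The integral over slices needed for the cross-polytope. The integrand is a polynomial on
  each side of 0, so each half has an explicit antiderivative.\<close>

lemma nn_integral_abs_power:
  assumes "t \<ge> (0::real)"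
  shows "(\<integral>\<^sup>+ y. ennreal ((2 * (t - \<bar>y\<bar>)) ^ m) * indicator {-t..t} y \<partial>lborel) = ennreal ((2 * t) ^ Suc m / Suc m)"
proof -
  have d1: "((\<lambda>y. - ((2 * (t - y)) ^ Suc m / (2 * real (Suc m)))) has_real_derivative (2 * (t - y)) ^ m) (at y)" for y
    by (rule derivative_eq_intros refl | simp del: of_nat_Suc power_Suc)+
  have d2: "((\<lambda>y. (2 * (t + y)) ^ Suc m / (2 * real (Suc m))) has_real_derivative (2 * (t + y)) ^ m) (at y)" for y
    by (rule derivative_eq_intros refl | simp del: of_nat_Suc power_Suc)+
  have 1: "(\<integral>\<^sup>+ y. ennreal ((2 * (t - y)) ^ m) * indicator {0..t} y \<partial>lborel) =
      ennreal ((2 * t) ^ Suc m / (2 * real (Suc m)))"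
    using assms by (subst nn_integral_FTC_Icc[OF _ d1]) auto
  have 2: "(\<integral>\<^sup>+ y. ennreal ((2 * (t + y)) ^ m) * indicator {-t..0} y \<partial>lborel) =
      ennreal ((2 * t) ^ Suc m / (2 * real (Suc m)))"
    using assms by (subst nn_integral_FTC_Icc[OF _ d2]) auto
  have m: "(\<lambda>y. ennreal ((2 * (t - y)) ^ m) * indicator {0..t} y) \<in> borel_measurable lborel"
    "(\<lambda>y. ennreal ((2 * (t + y)) ^ m) * indicator {-t..0} y) \<in> borel_measurable lborel"
    by measurable
  \<comment> \<open>Both halves contain 0 and their sum counts the integrand twice there, which is
    harmless up to a null set.\<close>
  have "AE y in lborel. y \<notin> {0::real}"
    by (intro AE_not_in countable_imp_null_set_lborel) auto
  then have "(\<integral>\<^sup>+ y. ennreal ((2 * (t - \<bar>y\<bar>)) ^ m) * indicator {-t..t} y \<partial>lborel) =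
    (\<integral>\<^sup>+ y. ennreal ((2 * (t - y)) ^ m) * indicator {0..t} y + ennreal ((2 * (t + y)) ^ m) * indicator {-t..0} y \<partial>lborel)"
    by (intro nn_integral_cong_AE) (auto simp: indicator_def elim!: eventually_mono)
  also have "\<dots> = ennreal ((2 * t) ^ Suc m / (2 * real (Suc m))) + ennreal ((2 * t) ^ Suc m / (2 * real (Suc m)))"
    by (subst nn_integral_add) (simp_all only: 1 2 m)
  also have "\<dots> = ennreal ((2 * t) ^ Suc m / Suc m)"
  proof -
    have "x / (2 * r) + x / (2 * r) = x / r" for x r :: real by (simp add: field_simps)
    then show ?thesis
      using assms by (subst ennreal_plus[symmetric]) (simp_all del: of_nat_Suc power_Suc)
  qed
  finally show ?thesis .
qed

text \<open>The slice at \<open>c b = y\<close> is a cross-polytope of radius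
  \<open>t - \<bar>y\<bar>\<close> in one dimension less, so the induction runs over all radii at
  once.\<close>

lemma emeasure_cross_polytope:
  assumes "finite (A :: 'a set)" "(t :: real) \<ge> 0"
  shows "emeasure (Pi\<^sub>M A (\<lambda>_. lborel)) ({c. (\<Sum>i\<in>A. \<bar>c i\<bar>) \<le> t} \<inter> space (Pi\<^sub>M A (\<lambda>_. lborel)))
     = ennreal ((2 * t) ^ card A / fact (card A))"
  using assms
proof (induction arbitrary: t rule: finite_induct)
  case (empty t)
  then show ?case by (simp add: PiM_empty)
next
  case (insert b A t)
  interpret product_sigma_finite "\<lambda>_. lborel" by standard
  let ?M = "\<lambda>A. Pi\<^sub>M A (\<lambda>_. lborel) :: ('a \<Rightarrow> real) measure"
  let ?S = "\<lambda>A t. {c. (\<Sum>i\<in>A. \<bar>c i\<bar>) \<le> t} \<inter> space (?M A)"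
  have meas: "?S A t \<in> sets (?M A)" if "finite A" for A :: "'a set" and t :: real
    using that by measurable
  \<comment> \<open>The factor \<open>indicator {-t..t} y\<close> keeps the radius
    \<open>t - \<bar>y\<bar>\<close> nonnegative, as the induction hypothesis demands.\<close>
  have upd: "indicator (?S (insert b A) t) (c(b := y)) =
      (indicator {-t..t} y * indicator (?S A (t - \<bar>y\<bar>)) c :: ennreal)"
    if "c \<in> space (?M A)" for c y
  proof -
    have "(\<Sum>i\<in>A. \<bar>if i = b then y else c i\<bar>) = (\<Sum>i\<in>A. \<bar>c i\<bar>)"
      using insert.hyps by (intro sum.cong) auto
    moreover have "\<bar>y\<bar> + s \<le> t \<longleftrightarrow> y \<in> {-t..t} \<and> s \<le> t - \<bar>y\<bar>" if "0 \<le> s" for s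
      using that by auto
    moreover have "0 \<le> (\<Sum>i\<in>A. \<bar>c i\<bar>)" by (simp add: sum_nonneg)
    ultimately have "(\<Sum>i\<in>insert b A. \<bar>(c(b := y)) i\<bar>) \<le> t \<longleftrightarrow> y \<in> {-t..t} \<and> (\<Sum>i\<in>A. \<bar>c i\<bar>) \<le> t - \<bar>y\<bar>"
      using insert.hyps by simp
    then show ?thesis
      using that by (auto simp: indicator_def space_PiM PiE_def extensional_def)
  qed
  have "emeasure (?M (insert b A)) (?S (insert b A) t) = (\<integral>\<^sup>+ c. indicator (?S (insert b A) t) c \<partial>?M (insert b A))"
    using insert.hyps by (intro nn_integral_indicator[symmetric] meas) auto
  also have "\<dots> = (\<integral>\<^sup>+ y. \<integral>\<^sup>+ c. indicator (?S (insert b A) t) (c(b := y)) \<partial>?M A \<partial>lborel)"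
    using insert.hyps meas[of "insert b A" t] by (intro product_nn_integral_insert_rev) auto
  also have "\<dots> = (\<integral>\<^sup>+ y. \<integral>\<^sup>+ c. indicator {-t..t} y * indicator (?S A (t - \<bar>y\<bar>)) c \<partial>?M A \<partial>lborel)"
    by (intro nn_integral_cong upd)
  also have "\<dots> = (\<integral>\<^sup>+ y. indicator {-t..t} y * emeasure (?M A) (?S A (t - \<bar>y\<bar>)) \<partial>lborel)"
    using insert.hyps meas by (simp add: nn_integral_cmult)
  also have "\<dots> = (\<integral>\<^sup>+ y. ennreal (1 / fact (card A)) * (ennreal ((2 * (t - \<bar>y\<bar>)) ^ card A) * indicator {-t..t} y) \<partial>lborel)"
  proof (intro nn_integral_cong)
    fix y :: real
    show "indicator {-t..t} y * emeasure (?M A) (?S A (t - \<bar>y\<bar>)) =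
      ennreal (1 / fact (card A)) * (ennreal ((2 * (t - \<bar>y\<bar>)) ^ card A) * indicator {-t..t} y)"
      by (cases "y \<in> {-t..t}") (auto simp: insert.IH ennreal_mult'[symmetric])
  qed
  also have "\<dots> = ennreal (1 / fact (card A)) * ennreal ((2 * t) ^ Suc (card A) / Suc (card A))"
    using insert.prems by (subst nn_integral_cmult) (simp_all only: nn_integral_abs_power, simp)
  also have "\<dots> = ennreal ((2 * t) ^ card (insert b A) / fact (card (insert b A)))"
    using insert.hyps insert.prems by (simp add: ennreal_mult'[symmetric] field_simps)
  finally show ?case .
qed

section \<open>Volume comparison for coverings and its explicit constant\<close>

text \<open>The preimage \<open>D y\<close> of a ball under the triangular map has the ball's volume
  divided by \<open>?p\<close>. At most \<open>2 ^ card A\<close> of these cover the cross-polytope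
  \<open>K\<close>, and this number cancels the power of 2 in the volume of
  \<open>K\<close>.\<close>

lemma prod_diag_le_of_covering:
  fixes a :: "nat \<Rightarrow> nat \<Rightarrow> real"
  assumes A: "finite A" and pos: "\<And>i. i \<in> A \<Longrightarrow> a i i > 0"
    and tri: "\<And>i j. i \<in> A \<Longrightarrow> j \<in> A \<Longrightarrow> i < j \<Longrightarrow> a i j = 0"
    and C: "finite C" "card C \<le> 2 ^ card A" and e: "e > 0"
    and cov: "\<And>c. (\<Sum>i\<in>A. \<bar>c i\<bar>) \<le> 1 \<Longrightarrow>
      \<exists>y\<in>C. sqrt (\<Sum>j\<in>A. ((\<Sum>i\<in>A. c i * a i j) - y j)\<^sup>2) \<le> e"
  shows "(\<Prod>i\<in>A. a i i) \<le> fact (card A) * unit_ball_vol (card A) * e ^ card A"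
proof -
  let ?M = "Pi\<^sub>M A (\<lambda>_. lborel) :: (nat \<Rightarrow> real) measure"
  let ?T = "\<lambda>y c. \<lambda>j\<in>A. (\<Sum>i\<in>A. c i * a i j) - y j"
  let ?p = "\<Prod>i\<in>A. a i i"
  define V where "V = unit_ball_vol (card A) * e ^ card A"
  define B where "B = {f. sqrt (\<Sum>i\<in>A. (f i)\<^sup>2) \<le> e} \<inter> space ?M"
  define D where "D = (\<lambda>y. ?T y -` B \<inter> space ?M)"
  define K where "K = {c. (\<Sum>i\<in>A. \<bar>c i\<bar>) \<le> 1} \<inter> space ?M"
  have p: "?p > 0" using pos by (intro prod_pos) auto
  have V: "V \<ge> 0" using e by (simp add: V_def)
  have T: "?T y \<in> ?M \<rightarrow>\<^sub>M ?M" for y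
    using A by measurable
  have B: "B \<in> sets ?M" unfolding B_def using A by measurable
  have D: "D y \<in> sets ?M" for y unfolding D_def using T B by (rule measurable_sets)
  have vol: "ennreal ?p * emeasure ?M (D y) = ennreal V" for y
  proof -
    have "emeasure ?M (D y) = (\<integral>\<^sup>+ c. indicator (D y) c \<partial>?M)"
      using D by simp
    also have "\<dots> = (\<integral>\<^sup>+ c. indicator B (?T y c) \<partial>?M)"
      by (intro nn_integral_cong) (auto simp: D_def indicator_def)
    also have "ennreal ?p * \<dots> = (\<integral>\<^sup>+ c. indicator B c \<partial>?M)"
      using B by (intro nn_integral_PiM_triangular A pos tri) auto
    also have "\<dots> = ennreal V"
      using B emeasure_cball_aux[OF A e] by (simp add: B_def V_def)
    finally show ?thesis .
  qed
  have "K \<subseteq> (\<Union>y\<in>C. D y)"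
  proof
    fix c assume c: "c \<in> K"
    then obtain y where y: "y \<in> C" "sqrt (\<Sum>j\<in>A. ((\<Sum>i\<in>A. c i * a i j) - y j)\<^sup>2) \<le> e"
      using cov unfolding K_def by blast
    have "?T y c \<in> B"
      using y(2) unfolding B_def by (auto simp: space_PiM)
    then show "c \<in> (\<Union>y\<in>C. D y)" using y c by (auto simp: D_def K_def)
  qed
  then have "emeasure ?M K \<le> (\<Sum>y\<in>C. emeasure ?M (D y))"
    using D C by (intro order_trans[OF emeasure_mono emeasure_subadditive_finite]) auto
  then have "ennreal ?p * emeasure ?M K \<le> ennreal ?p * (\<Sum>y\<in>C. emeasure ?M (D y))"
    by (intro mult_left_mono) auto
  also have "\<dots> = ennreal (card C * V)"
    by (simp add: sum_distrib_left vol ennreal_mult ennreal_of_nat_eq_real_of_nat V)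
  also have "emeasure ?M K = ennreal (2 ^ card A / fact (card A))"
    using emeasure_cross_polytope[OF A, of 1] by (simp add: K_def)
  finally have "?p * (2 ^ card A / fact (card A)) \<le> card C * V"
    using V p by (simp add: ennreal_mult'[symmetric])
  also have "\<dots> \<le> 2 ^ card A * V"
    using C V by (intro mult_right_mono) (metis of_nat_le_iff of_nat_numeral of_nat_power, auto)
  finally have "?p \<le> fact (card A) * V"
    by (simp add: field_simps)
  then show ?thesis by (simp add: V_def mult.assoc)
qed

text \<open>The functional equation of \<open>Gamma\<close> relates the ball volumes in dimensions
  \<open>n\<close> and \<open>n - 2\<close>, so the induction goes in steps of two from
  \<open>n = 1\<close> and \<open>n = 2\<close>. Squaring keeps square roots out of the
  estimate.\<close>

lemma fact_unit_ball_vol_le: "n \<ge> 1 \<Longrightarrow> (fact n * unit_ball_vol (real n))\<^sup>2 \<le> (5 * real n) ^ n"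
proof (induction n rule: nat_less_induct)
  case (1 n)
  show ?case
  proof (cases "n \<le> 2")
    case True
    with 1(2) consider "n = 1" | "n = 2" by linarith
    then show ?thesis
    proof cases
      case 2
      have "4 * pi\<^sup>2 \<le> 4 * 4\<^sup>2" using pi_less_4 by (intro mult_left_mono power_mono) auto
      then show ?thesis using 2 by (simp add: unit_ball_vol_2 power2_eq_square)
    qed (simp add: unit_ball_vol_1)
  next
    case False
    then obtain m where m: "n = Suc (Suc m)" "m \<ge> 1" 
      by (metis Suc_leI add_2_eq_Suc le_add_diff_inverse nat_le_linear not_le zero_less_diff One_nat_def)
    have ub: "unit_ball_vol (real n) = 2 * pi / n * unit_ball_vol (real m)"
    proof -
      have "Gamma (real m / 2 + 1 + 1) = (real m / 2 + 1) * Gamma (real m / 2 + 1)"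
        by (intro Gamma_plus1) (auto dest: nonpos_Ints_nonpos)
      moreover have "pi powr (real m / 2 + 1) = pi * pi powr (real m / 2)"
        by (simp add: powr_add)
      moreover have "real n / 2 = real m / 2 + 1" using m by (simp add: field_simps)
      moreover have "Gamma (real m / 2 + 1) > 0" by (intro Gamma_real_pos) auto
      ultimately have "unit_ball_vol (real n) = pi * pi powr (real m / 2) / ((real m / 2 + 1) * Gamma (real m / 2 + 1))"
        by (simp only: unit_ball_vol_def)
      also have "\<dots> = 2 * pi / (real m + 2) * (pi powr (real m / 2) / Gamma (real m / 2 + 1))"
        by (simp add: divide_simps)
      finally show ?thesis using m by (simp add: unit_ball_vol_def)
    qed
    have f: "fact n * unit_ball_vol (real n) = 2 * pi * (m + 1) * (fact m * unit_ball_vol (real m))"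
    proof -
      have n: "fact n = (real m + 2) * ((real m + 1) * fact m)" "real n = real m + 2"
        using m by (simp_all add: algebra_simps)
      show ?thesis unfolding ub unfolding n by simp
    qed
    \<comment> \<open>The constant 75 is 25 times 3: the 25 comes from two factors
      \<open>5 * n\<close>, the 3 from Bernoulli's inequality for \<open>(1 + 2 / m) ^ m\<close>. It
      leaves room for \<open>pi < 4\<close>, which costs 64.\<close>
    have "(2 * pi)\<^sup>2 \<le> (2 * 4)\<^sup>2" using pi_less_4 by (intro power_mono) auto
    then have "(2 * pi * (m + 1))\<^sup>2 \<le> 75 * (real m + 2)\<^sup>2"
      unfolding power_mult_distrib by (intro mult_mono power_mono) auto
    also have "75 * (real m + 2)\<^sup>2 * (5 * real m) ^ m \<le> (5 * real n) ^ n"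
    proof -
      have "1 + real m * (2 / m) \<le> (1 + 2 / m) ^ m"
        by (rule Bernoulli_inequality) (use m in \<open>auto intro: order_trans[of _ 0]\<close>)
      then have "3 \<le> (1 + 2 / m) ^ m" using m by simp
      then have le: "3 * (5 * real m) ^ m \<le> (1 + 2 / m) ^ m * (5 * real m) ^ m"
        by (intro mult_right_mono) auto
      have "(1 + 2 / m) * (5 * real m) = 5 * real n"
        using m by (simp add: distrib_right)
      then have "(1 + 2 / m) ^ m * (5 * real m) ^ m = (5 * real n) ^ m"
        by (simp only: power_mult_distrib[symmetric])
      with le have "25 * (real m + 2)\<^sup>2 * (3 * (5 * real m) ^ m) \<le> 25 * (real m + 2)\<^sup>2 * (5 * real n) ^ m"
        by (intro mult_left_mono) auto
      also have "25 * (real m + 2)\<^sup>2 * (5 * real n) ^ m = (5 * real n) ^ n"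
      proof -
        have "real n = real m + 2" "n = 2 + m" using m by auto
        then show ?thesis by (simp only: power_add power_mult_distrib) simp
      qed
      finally show ?thesis by simp
    qed
    finally have *: "(2 * pi * (m + 1))\<^sup>2 * (5 * real m) ^ m \<le> (5 * real n) ^ n"
      by (simp add: mult_right_mono)
    have "(fact m * unit_ball_vol (real m))\<^sup>2 \<le> (5 * real m) ^ m"
      using 1(1) m by auto
    then have "(2 * pi * (m + 1))\<^sup>2 * (fact m * unit_ball_vol (real m))\<^sup>2 \<le> (2 * pi * (m + 1))\<^sup>2 * (5 * real m) ^ m"
      by (intro mult_left_mono) auto
    with * show ?thesis by (simp only: f power_mult_distrib)
  qed
qed

section \<open>Powers and geometric means\<close>

lemma rpow_nonneg [simp]: "0 \<le> rpow t a"
  by (simp add: rpow_def)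

lemma rpow_pos: "0 < t \<Longrightarrow> rpow t a = t powr a"
  by (simp add: rpow_def)

lemma rpow_mono: "0 \<le> s \<Longrightarrow> s \<le> t \<Longrightarrow> 0 \<le> a \<Longrightarrow> rpow s a \<le> rpow t a"
  by (simp add: rpow_def powr_mono2)

lemma rpow_mult: "0 \<le> s \<Longrightarrow> 0 \<le> t \<Longrightarrow> rpow (s * t) a = rpow s a * rpow t a"
  by (simp add: rpow_def powr_mult)

lemma rpow_prod: "(\<And>i. i \<in> A \<Longrightarrow> 0 \<le> q i) \<Longrightarrow> rpow (prod q A) a = (\<Prod>i\<in>A. rpow (q i) a)"
proof (induction A rule: infinite_finite_induct)
  case (insert i A)
  then show ?case by (simp add: rpow_mult prod_nonneg)
qed (simp_all add: rpow_def)

text \<open>AM-GM applied to the squares of the \<open>q i\<close>, whose arithmetic mean is at most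
  \<open>N\<^sup>2 / card A\<close>; the roots are taken at the end.\<close>

lemma prod_le_sum_squares:
  fixes q :: "'a \<Rightarrow> real"
  assumes A: "finite A" "A \<noteq> {}" and q: "\<And>i. i \<in> A \<Longrightarrow> 0 \<le> q i"
    and N: "0 \<le> N" "(\<Sum>i\<in>A. (q i)\<^sup>2) \<le> N\<^sup>2"
  shows "prod q A \<le> (N / sqrt (card A)) ^ card A"
proof -
  have c: "card A > 0" using A by (simp add: card_gt_0_iff)
  let ?p = "\<Prod>i\<in>A. (q i)\<^sup>2"
  have p: "?p \<ge> 0" by (intro prod_nonneg) auto
  have "?p powr (1 / card A) \<le> (\<Sum>i\<in>A. (q i)\<^sup>2 / card A)"
    using A by (intro arith_geom_mean) auto
  also have "\<dots> \<le> N\<^sup>2 / card A"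
    using N c by (simp add: sum_divide_distrib[symmetric] divide_right_mono)
  finally have "(?p powr (1 / card A)) ^ card A \<le> (N\<^sup>2 / card A) ^ card A"
    by (intro power_mono) auto
  also have "(?p powr (1 / card A)) ^ card A = ?p"
    using p c by (cases "?p = 0") (auto simp: powr_realpow[symmetric] powr_powr)
  also have "?p = (prod q A)\<^sup>2" by (simp add: prod_power_distrib)
  also have "(N\<^sup>2 / card A) ^ card A = ((N / sqrt (card A)) ^ card A)\<^sup>2"
  proof -
    have "N\<^sup>2 / card A = (N / sqrt (card A))\<^sup>2" by (simp add: power_divide)
    then show ?thesis by (metis power_mult mult.commute)
  qed
  finally show ?thesis
    by (rule power2_le_imp_le) (use N in simp)
qed

section \<open>The selection criterion as a function of residual and power function values\<close>

text \<open>Used at the selected point: it splits the criterion into a power of the Newton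
  coefficient \<open>t / p\<close>, which Bessel's inequality controls, and the factor
  \<open>p\<close>, which the entropy numbers control.\<close>

lemma rpow_eta_eq:
  assumes "0 \<le> t" "0 < p"
  shows "rpow t b * rpow p (1 - b) = rpow (t / p) b * p"
proof -
  have "rpow t b = rpow (t / p) b * p powr b"
    using assms rpow_mult[of "t / p" p b] by (simp add: rpow_pos)
  moreover have "p powr b * p powr (1 - b) = p"
    using assms by (simp add: powr_add[symmetric])
  ultimately show ?thesis using assms by (simp add: rpow_pos)
qed

text \<open>Bounds the criterion uniformly in the point, so that the supremum in
  \<open>weak_greedy\<close> is a genuine one: \<open>t / p \<le> N\<close>, and the remaining
  factor \<open>p\<close> is at most 1.\<close>

lemma rpow_eta_le:
  assumes "0 \<le> t" "0 < p" "p \<le> 1" "t \<le> N * p" "0 \<le> b"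
  shows "rpow t b * rpow p (1 - b) \<le> rpow N b"
proof -
  have "rpow (t / p) b * p \<le> rpow N b * 1"
    using assms by (intro mult_mono rpow_mono) (auto simp: field_simps)
  then show ?thesis using assms by (simp add: rpow_eta_eq)
qed

lemma powr_le_rpow_eta:
  assumes "0 \<le> t" "0 < p" "p \<le> 1" "t \<le> N * p" "0 \<le> b" "0 < N"
  shows "t powr max 1 b \<le> rpow t b * rpow p (1 - b) * N powr (max 1 b - b)"
proof (cases "t = 0")
  case False
  with assms have t: "t > 0" by simp
  show ?thesis
  proof (cases "b \<le> 1")
    case True
    have "t powr 1 = t powr b * t powr (1 - b)" by (simp add: powr_add[symmetric])
    also have "\<dots> \<le> t powr b * (N * p) powr (1 - b)"
      using t True assms by (intro mult_left_mono powr_mono2) auto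
    finally show ?thesis
      using True assms t by (simp add: max_def rpow_pos powr_mult mult_ac)
  next
    case False
    have "p powr 0 \<le> p powr (1 - b)" using False assms by (intro powr_mono') auto
    then have "t powr b * 1 \<le> t powr b * p powr (1 - b)" using assms by (intro mult_left_mono) auto
    then show ?thesis using False assms t by (simp add: max_def rpow_pos)
  qed
qed simp

text \<open>The exponent \<open>max 1 b\<close> lets \<open>\<beta> \<le> 1\<close> and \<open>\<beta> > 1\<close> be treated at once: both reduce to the same
  hypothesis on the single steps.\<close>

lemma geometric_mean_rate:
  fixes M N \<gamma> \<epsilon> b :: real and q P :: "'a \<Rightarrow> real" and A :: "'a set"
  defines "B \<equiv> max 1 b" and "n \<equiv> card A"
  assumes A: "finite A" "A \<noteq> {}" and M: "0 < M" and N: "0 < N"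
    and \<gamma>: "0 < \<gamma>" "\<gamma> \<le> 1" and b: "0 \<le> b"
    and q: "\<And>i. i \<in> A \<Longrightarrow> 0 \<le> q i" "(\<Sum>i\<in>A. (q i)\<^sup>2) \<le> N\<^sup>2"
    and P: "\<And>i. i \<in> A \<Longrightarrow> 0 < P i" "prod P A \<le> (sqrt (5 * n) * \<epsilon>) ^ n" and \<epsilon>: "0 \<le> \<epsilon>"
    and le: "\<And>i. i \<in> A \<Longrightarrow> \<gamma> * M powr B \<le> rpow (q i) b * P i * N powr (B - b)"
  shows "M \<le> inverse \<gamma> * (sqrt 5 * n powr ((1 - b) / 2) * \<epsilon>) powr (1 / B) * N"
proof -
  have n: "n > 0" using A by (simp add: n_def card_gt_0_iff)
  have B: "B \<ge> 1" by (simp add: B_def)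
  let ?Q = "sqrt 5 * n powr ((1 - b) / 2) * \<epsilon>"
  have "(\<gamma> * M powr B) ^ n = (\<Prod>i\<in>A. \<gamma> * M powr B)" by (simp add: n_def)
  also have "\<dots> \<le> (\<Prod>i\<in>A. rpow (q i) b * P i * N powr (B - b))"
    using le \<gamma> by (intro prod_mono) auto
  also have "\<dots> = rpow (prod q A) b * prod P A * (N powr (B - b)) ^ n"
    using q by (simp add: prod.distrib rpow_prod n_def)
  also have "\<dots> \<le> (rpow (N / sqrt n) b) ^ n * (sqrt (5 * n) * \<epsilon>) ^ n * (N powr (B - b)) ^ n"
  proof (intro mult_right_mono mult_mono)
    have "rpow (prod q A) b \<le> rpow ((N / sqrt n) ^ n) b"
      unfolding n_def using q A N b by (intro rpow_mono prod_le_sum_squares prod_nonneg) auto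
    also have "\<dots> = (rpow (N / sqrt n) b) ^ n"
      using rpow_prod[of "{..<n}" "\<lambda>_. N / sqrt n" b] N by simp
    finally show "rpow (prod q A) b \<le> (rpow (N / sqrt n) b) ^ n" .
  qed (use P \<epsilon> in \<open>auto simp: prod_nonneg less_imp_le\<close>)
  also have "\<dots> = (rpow (N / sqrt n) b * (sqrt (5 * n) * \<epsilon>) * N powr (B - b)) ^ n"
    by (simp add: power_mult_distrib)
  finally have "\<gamma> * M powr B \<le> rpow (N / sqrt n) b * (sqrt (5 * n) * \<epsilon>) * N powr (B - b)"
    using n \<epsilon> by (subst (asm) power_mono_iff) (use \<gamma> in auto)
  also have "\<dots> = N powr B * ?Q"
  proof -
    \<comment> \<open>The power of \<open>n\<close> combines \<open>n powr (- b / 2)\<close> from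
      Bessel and AM-GM with \<open>n powr (1 / 2)\<close> from the volume constant.\<close>
    have 1: "rpow (N / sqrt n) b = N powr b * n powr (- b / 2)"
      using N n by (simp add: rpow_pos powr_divide powr_half_sqrt[symmetric] powr_powr powr_minus field_simps)
    have 2: "sqrt (5 * n) = sqrt 5 * n powr (1 / 2)"
      using n by (simp add: real_sqrt_mult powr_half_sqrt)
    have 3: "n powr (- b / 2) * n powr (1 / 2) = n powr ((1 - b) / 2)"
      by (simp add: powr_add[symmetric] diff_divide_distrib)
    have 4: "N powr b * N powr (B - b) = N powr B"
      by (simp add: powr_add[symmetric])
    have "rpow (N / sqrt n) b * (sqrt (5 * n) * \<epsilon>) * N powr (B - b) =
        (N powr b * N powr (B - b)) * (sqrt 5 * (n powr (- b / 2) * n powr (1 / 2)) * \<epsilon>)"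
      unfolding 1 2 by (simp only: mult.assoc mult.left_commute mult.commute)
    then show ?thesis by (simp only: 3 4)
  qed
  finally have "M powr B \<le> inverse \<gamma> * (N powr B * ?Q)"
    using \<gamma> by (simp add: field_simps)
  then have "(M powr B) powr (1 / B) \<le> (inverse \<gamma> * (N powr B * ?Q)) powr (1 / B)"
    using B by (intro powr_mono2) auto
  also have "(M powr B) powr (1 / B) = M" using M B by (simp add: powr_powr)
  also have "(inverse \<gamma> * (N powr B * ?Q)) powr (1 / B) = inverse \<gamma> powr (1 / B) * (N * ?Q powr (1 / B))"
    using \<gamma> N B \<epsilon> by (simp only: powr_mult powr_powr) (simp add: powr_powr)
  \<comment> \<open>The root produces the sharper factor
    \<open>inverse \<gamma> powr (1 / B)\<close>; since \<open>\<gamma> \<le> 1 \<le> B\<close> it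
    is at most \<open>inverse \<gamma>\<close>.\<close>
  also have "\<dots> \<le> inverse \<gamma> * (N * ?Q powr (1 / B))"
  proof (intro mult_right_mono)
    have "inverse \<gamma> powr (1 / B) \<le> inverse \<gamma> powr 1"
      using \<gamma> B by (intro powr_mono) (auto simp: one_le_inverse)
    then show "inverse \<gamma> powr (1 / B) \<le> inverse \<gamma>" using \<gamma> by simp
  qed (use N in auto)
  finally show ?thesis by (simp add: mult_ac)
qed

section \<open>Projections in reproducing kernel Hilbert spaces\<close>

locale inner_functions =
  fixes S :: "'a set" and H :: "'a fun_space"
  assumes inner_fun_space: "inner_fun_space S H"
begin

lemma funs_0 [simp]: "(\<lambda>x. 0) \<in> funs H"
  and funs_add: "f \<in> funs H \<Longrightarrow> g \<in> funs H \<Longrightarrow> (\<lambda>x. f x + g x) \<in> funs H"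
  and funs_scale: "f \<in> funs H \<Longrightarrow> (\<lambda>x. c * f x) \<in> funs H"
  and ip_add_left: "f \<in> funs H \<Longrightarrow> g \<in> funs H \<Longrightarrow> h \<in> funs H \<Longrightarrow> ip H (\<lambda>x. f x + g x) h = ip H f h + ip H g h"
  and ip_scale_left: "f \<in> funs H \<Longrightarrow> g \<in> funs H \<Longrightarrow> ip H (\<lambda>x. c * f x) g = c * ip H f g"
  and ip_commute: "f \<in> funs H \<Longrightarrow> g \<in> funs H \<Longrightarrow> ip H f g = ip H g f"
  and ip_pos: "f \<in> funs H \<Longrightarrow> f \<noteq> (\<lambda>x. 0) \<Longrightarrow> 0 < ip H f f"
  using inner_fun_space unfolding inner_fun_space_def by blast+

lemma funs_diff: "f \<in> funs H \<Longrightarrow> g \<in> funs H \<Longrightarrow> f - g \<in> funs H"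
  using funs_add[OF _ funs_scale[of g "-1"], of f] by (simp add: fun_diff_def)

lemma funs_sum: "(\<And>i. i \<in> A \<Longrightarrow> g i \<in> funs H) \<Longrightarrow> (\<lambda>x. \<Sum>i\<in>A. c i * g i x) \<in> funs H"
  by (induction A rule: infinite_finite_induct) (simp_all add: funs_add[OF funs_scale])

lemma ip_0_left: "f \<in> funs H \<Longrightarrow> ip H (\<lambda>x. 0) f = 0"
  using ip_scale_left[of f f 0] by simp

lemma ip_diff_left:
  "f \<in> funs H \<Longrightarrow> g \<in> funs H \<Longrightarrow> h \<in> funs H \<Longrightarrow> ip H (f - g) h = ip H f h - ip H g h"
  using ip_add_left[OF _ funs_scale[of g "-1"], of f h] ip_scale_left[of g h "-1"]
  by (simp add: fun_diff_def)

lemma ip_diff_right: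
  "f \<in> funs H \<Longrightarrow> g \<in> funs H \<Longrightarrow> h \<in> funs H \<Longrightarrow> ip H h (f - g) = ip H h f - ip H h g"
  by (simp add: ip_commute[of h] ip_diff_left funs_diff)

lemma ip_scale_right: "f \<in> funs H \<Longrightarrow> g \<in> funs H \<Longrightarrow> ip H f (\<lambda>x. c * g x) = c * ip H f g"
  by (simp add: ip_commute[of f] ip_scale_left funs_scale)

lemma ip_sum_left:
  "(\<And>i. i \<in> A \<Longrightarrow> g i \<in> funs H) \<Longrightarrow> h \<in> funs H \<Longrightarrow>
    ip H (\<lambda>x. \<Sum>i\<in>A. c i * g i x) h = (\<Sum>i\<in>A. c i * ip H (g i) h)"
proof (induction A rule: infinite_finite_induct)
  case (insert a A)
  then show ?case
    by (simp add: ip_add_left[OF funs_scale funs_sum] ip_scale_left)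
qed (auto simp: ip_0_left)

lemma ip_sum_right:
  "(\<And>i. i \<in> A \<Longrightarrow> g i \<in> funs H) \<Longrightarrow> h \<in> funs H \<Longrightarrow>
    ip H h (\<lambda>x. \<Sum>i\<in>A. c i * g i x) = (\<Sum>i\<in>A. c i * ip H h (g i))"
  using ip_sum_left[of A g h c] funs_sum[of A g c] by (simp add: ip_commute[of h])

lemma ip_self_nonneg: "f \<in> funs H \<Longrightarrow> 0 \<le> ip H f f"
  using ip_pos ip_0_left[of f] by (cases "f = (\<lambda>x. 0)") (auto simp: less_imp_le)

lemma ip_self_eq_0: "f \<in> funs H \<Longrightarrow> ip H f f = 0 \<longleftrightarrow> f = (\<lambda>x. 0)"
  using ip_pos ip_0_left[of f] by force

lemma hnorm_nonneg [simp]: "f \<in> funs H \<Longrightarrow> 0 \<le> hnorm H f"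
  by (simp add: hnorm_def ip_self_nonneg)

lemma hnorm_power2: "f \<in> funs H \<Longrightarrow> (hnorm H f)\<^sup>2 = ip H f f"
  by (simp add: hnorm_def ip_self_nonneg)

lemma abs_ip_le: "f \<in> funs H \<Longrightarrow> g \<in> funs H \<Longrightarrow> \<bar>ip H f g\<bar> \<le> hnorm H f * hnorm H g"
  using inner_fun_space_cauchy_schwarz[OF inner_fun_space, of f g]
  by (simp add: hnorm_def real_sqrt_mult[symmetric] real_le_rsqrt)

lemma bessel:
  assumes A: "finite A" and e: "\<And>i. i \<in> A \<Longrightarrow> e i \<in> funs H"
    and on: "\<And>i j. i \<in> A \<Longrightarrow> j \<in> A \<Longrightarrow> ip H (e i) (e j) = (if i = j then 1 else 0)"
    and g: "g \<in> funs H"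
  shows "(\<Sum>i\<in>A. (ip H g (e i))\<^sup>2) \<le> ip H g g"
proof -
  define s where "s = (\<lambda>x. \<Sum>i\<in>A. ip H g (e i) * e i x)"
  have s: "s \<in> funs H" unfolding s_def using e by (rule funs_sum)
  have se: "ip H s (e j) = ip H g (e j)" if "j \<in> A" for j
    using A that e by (simp add: s_def ip_sum_left on if_distrib sum.delta cong: if_cong)
  have ss: "ip H h s = (\<Sum>i\<in>A. ip H g (e i) * ip H h (e i))" if "h \<in> funs H" for h
    unfolding s_def using e that by (rule ip_sum_right)
  have "0 \<le> ip H (g - s) (g - s)" using g s by (simp add: ip_self_nonneg funs_diff)
  also have "\<dots> = ip H g g - ip H g s - (ip H g s - ip H s s)"
    using g s by (simp add: ip_diff_left ip_diff_right funs_diff ip_commute[of s g])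
  also have "ip H s s = ip H g s" using g s by (simp add: ss se)
  also have "ip H g s = (\<Sum>i\<in>A. (ip H g (e i))\<^sup>2)" using g by (simp add: ss power2_eq_square)
  finally show ?thesis by simp
qed

text \<open>A Gram-Schmidt step. Approximating \<open>f\<close> and the new \<open>h a\<close> from
  the old span leaves remainders \<open>p\<close> and \<open>r\<close> orthogonal to it; subtracting
  from \<open>p\<close> its component along \<open>r\<close> yields orthogonality to
  \<open>h a\<close> as well. Linear independence of the \<open>h x\<close> is not assumed.\<close>

lemma best_approximation_exists:
  assumes "finite X" "\<And>x. x \<in> X \<Longrightarrow> h x \<in> funs H" "f \<in> funs H"
  shows "\<exists>c. \<forall>x\<in>X. ip H (f - (\<lambda>y. \<Sum>x\<in>X. c x * h x y)) (h x) = 0"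
  using assms
proof (induction X arbitrary: f rule: finite_induct)
  case (insert a X)
  have h: "h x \<in> funs H" if "x \<in> insert a X" for x using insert.prems(1) that .
  let ?s = "\<lambda>c y. \<Sum>x\<in>X. c x * h x y"
  have s: "?s c \<in> funs H" for c using h by (intro funs_sum) auto
  have IH: "\<exists>c. \<forall>x\<in>X. ip H (f - ?s c) (h x) = 0" if "f \<in> funs H" for f
    using h that by (intro insert.IH) auto
  obtain c where c: "\<forall>x\<in>X. ip H (f - ?s c) (h x) = 0" using IH insert.prems by blast
  obtain d where d: "\<forall>x\<in>X. ip H (h a - ?s d) (h x) = 0" using IH[OF h[of a]] by blast
  define p r where "p = f - ?s c" and "r = h a - ?s d"
  have pr: "p \<in> funs H" "r \<in> funs H"
    using h s insert.prems by (auto simp: p_def r_def intro!: funs_diff)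
  define t where "t = ip H p r / ip H r r"
  \<comment> \<open>The coefficients of \<open>?s c + t * r\<close>, with
    \<open>r = h a - ?s d\<close> expanded.\<close>
  define c' where "c' = (\<lambda>x. if x = a then t else c x - t * d x)"
  have "(\<Sum>x\<in>insert a X. c' x * h x y) = t * h a y + (\<Sum>x\<in>X. (c x - t * d x) * h x y)" for y
    using insert.hyps by (simp add: c'_def cong: sum.cong) (intro sum.cong, auto)
  then have eq: "f - (\<lambda>y. \<Sum>x\<in>insert a X. c' x * h x y) = p - (\<lambda>y. t * r y)"
    by (auto simp: p_def r_def fun_eq_iff algebra_simps sum_subtractf sum_distrib_left)
  define u where "u = p - (\<lambda>y. t * r y)"
  have u: "u \<in> funs H" unfolding u_def using pr by (intro funs_diff funs_scale)
  have ip_u: "ip H u g = ip H p g - t * ip H r g" if "g \<in> funs H" for g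
    unfolding u_def using pr that by (simp add: ip_diff_left ip_scale_left funs_scale)
  have orth: "ip H u (h x) = 0" if "x \<in> X" for x
    using bspec[OF c that] bspec[OF d that] that h unfolding p_def[symmetric] r_def[symmetric]
    by (simp add: ip_u)
  \<comment> \<open>If \<open>r\<close> is zero, division by zero gives \<open>t = 0\<close> and
    both sides vanish.\<close>
  have "ip H p r = t * ip H r r"
    using pr ip_self_eq_0[of r] ip_0_left[of p] by (auto simp: t_def ip_commute[of p])
  then have "0 = ip H u r" using pr by (simp add: ip_u)
  also have "\<dots> = ip H u (h a) - ip H u (?s d)"
    using ip_diff_right[OF h[OF insertI1] s[of d] u] by (simp only: r_def[symmetric])
  also have "ip H u (?s d) = 0"
    using u h by (subst ip_sum_right) (auto simp: orth)
  finally have "\<forall>x\<in>insert a X. ip H u (h x) = 0" using orth by simp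
  then show ?case unfolding u_def eq[symmetric] by blast
qed simp

end

section \<open>Interpolation and power function through orthogonal projection\<close>

locale rkhs =
  fixes S :: "'a set" and k :: "'a \<Rightarrow> 'a \<Rightarrow> real" and H :: "'a fun_space"
  assumes is_rkhs: "is_rkhs S k H" and spd: "strictly_pos_def_on S k"
begin

sublocale inner_functions S H
  by standard (use is_rkhs in \<open>auto simp: is_rkhs_def hilbert_fun_space_def\<close>)

lemma ksec_funs [simp]: "x \<in> S \<Longrightarrow> ksec S k x \<in> funs H"
  and reproducing: "f \<in> funs H \<Longrightarrow> x \<in> S \<Longrightarrow> ip H f (ksec S k x) = f x"
  using is_rkhs by (auto simp: is_rkhs_def)

lemma kspan_funs: "X \<subseteq> S \<Longrightarrow> g \<in> kspan S k X \<Longrightarrow> g \<in> funs H"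
  by (auto simp: kspan_def intro!: funs_sum)

lemma ksec_in_kspan: "finite X \<Longrightarrow> x \<in> X \<Longrightarrow> ksec S k x \<in> kspan S k X"
  unfolding kspan_def
  by (intro CollectI exI[of _ "\<lambda>y. if y = x then 1 else 0"])
     (auto simp: if_distrib[of "\<lambda>c. c * _"] cong: if_cong)

lemma kspanI: "f = (\<lambda>y. \<Sum>x\<in>X. c x * ksec S k x y) \<Longrightarrow> f \<in> kspan S k X"
  by (auto simp: kspan_def)

lemma kspan_diff: "f \<in> kspan S k X \<Longrightarrow> g \<in> kspan S k X \<Longrightarrow> f - g \<in> kspan S k X"
proof -
  assume "f \<in> kspan S k X" "g \<in> kspan S k X"
  then obtain c d where "f = (\<lambda>y. \<Sum>x\<in>X. c x * ksec S k x y)" "g = (\<lambda>y. \<Sum>x\<in>X. d x * ksec S k x y)"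
    unfolding kspan_def by blast
  then have "f - g = (\<lambda>y. \<Sum>x\<in>X. (c x - d x) * ksec S k x y)"
    by (simp add: fun_eq_iff sum_subtractf left_diff_distrib)
  then show ?thesis by (rule kspanI)
qed

lemma kspan_mono:
  assumes "finite Y" "X \<subseteq> Y" shows "kspan S k X \<subseteq> kspan S k Y"
proof
  fix f assume "f \<in> kspan S k X"
  then obtain c where f: "f = (\<lambda>y. \<Sum>x\<in>X. c x * ksec S k x y)" unfolding kspan_def by blast
  have "(\<Sum>x\<in>Y. (if x \<in> X then c x else 0) * ksec S k x y) = f y" for y
    unfolding f using assms by (intro sum.mono_neutral_cong_right) auto
  then show "f \<in> kspan S k Y" by (intro kspanI[of _ "\<lambda>x. if x \<in> X then c x else 0"]) (simp add: fun_eq_iff)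
qed

text \<open>By the reproducing property, orthogonality to \<open>k(.,x)\<close> means vanishing at
  \<open>x\<close>. This is the bridge between interpolation and projection.\<close>

lemma orthogonal_kspan_iff:
  assumes "finite X" "X \<subseteq> S" "f \<in> funs H"
  shows "(\<forall>v\<in>kspan S k X. ip H f v = 0) \<longleftrightarrow> (\<forall>x\<in>X. f x = 0)"
proof
  assume "\<forall>v\<in>kspan S k X. ip H f v = 0"
  then show "\<forall>x\<in>X. f x = 0"
    using assms ksec_in_kspan[OF assms(1)] reproducing by fastforce
next
  assume "\<forall>x\<in>X. f x = 0"
  then have "ip H f (ksec S k x) = 0" if "x \<in> X" for x
    using assms that reproducing by auto
  then show "\<forall>v\<in>kspan S k X. ip H f v = 0"
    using assms by (auto simp: kspan_def ip_sum_right subset_iff)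
qed

text \<open>Justifies the definite description in \<open>hproj\<close> and, through
  \<open>interpolant_eq_hproj\<close>, the one in \<open>interpolant\<close>.\<close>

lemma projection_ex1:
  assumes X: "finite X" "X \<subseteq> S" and f: "f \<in> funs H"
  shows "\<exists>!g. g \<in> kspan S k X \<and> (\<forall>v\<in>kspan S k X. ip H (f - g) v = 0)"
proof (rule ex_ex1I)
  obtain c where c: "\<forall>x\<in>X. ip H (f - (\<lambda>y. \<Sum>x\<in>X. c x * ksec S k x y)) (ksec S k x) = 0"
    using best_approximation_exists[OF X(1) _ f, of "ksec S k"] X(2) ksec_funs by blast
  let ?g = "\<lambda>y. \<Sum>x\<in>X. c x * ksec S k x y"
  have g: "?g \<in> kspan S k X" by (rule kspanI) simp
  then have d: "f - ?g \<in> funs H" using assms kspan_funs by (intro funs_diff) auto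
  have "(f - ?g) x = 0" if "x \<in> X" for x
    using bspec[OF c that] reproducing[OF d, of x] that X(2) by (simp only: subsetD)
  then have "\<forall>v\<in>kspan S k X. ip H (f - ?g) v = 0"
    using orthogonal_kspan_iff[OF X d] by blast
  with g show "\<exists>g. g \<in> kspan S k X \<and> (\<forall>v\<in>kspan S k X. ip H (f - g) v = 0)" by blast
next
  fix g g'
  assume g: "g \<in> kspan S k X \<and> (\<forall>v\<in>kspan S k X. ip H (f - g) v = 0)"
    and g': "g' \<in> kspan S k X \<and> (\<forall>v\<in>kspan S k X. ip H (f - g') v = 0)"
  have gf: "g \<in> funs H" "g' \<in> funs H" using g g' X kspan_funs by auto
  have d: "g - g' \<in> kspan S k X" using g g' by (auto intro: kspan_diff)
  have "ip H (g - g') (g - g') = ip H (f - g') (g - g') - ip H (f - g) (g - g')"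
    using f gf by (simp add: ip_diff_left funs_diff)
  also have "\<dots> = 0" using g g' d by auto
  finally have "g - g' = (\<lambda>x. 0)" using gf ip_self_eq_0 funs_diff by blast
  then show "g = g'" by (simp add: fun_eq_iff)
qed

definition residual :: "'a set \<Rightarrow> ('a \<Rightarrow> real) \<Rightarrow> 'a \<Rightarrow> real" where
  "residual X f = f - interpolant S k X f"

lemma interpolant_eq_hproj:
  assumes X: "finite X" "X \<subseteq> S" and f: "f \<in> funs H"
  shows "interpolant S k X f = hproj H (kspan S k X) f"
proof -
  have "(g \<in> kspan S k X \<and> (\<forall>x\<in>X. g x = f x)) \<longleftrightarrow>
      (g \<in> kspan S k X \<and> (\<forall>v\<in>kspan S k X. ip H (f - g) v = 0))" for g
    using orthogonal_kspan_iff[OF X, of "f - g"] funs_diff[OF f] kspan_funs[OF X(2)] by auto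
  then show ?thesis unfolding interpolant_def hproj_def by presburger
qed

lemma
  assumes X: "finite X" "X \<subseteq> S" and f: "f \<in> funs H"
  shows interpolant_kspan: "interpolant S k X f \<in> kspan S k X"
    and residual_orthogonal: "v \<in> kspan S k X \<Longrightarrow> ip H (residual X f) v = 0"
    and residual_funs: "residual X f \<in> funs H"
proof -
  show 1: "interpolant S k X f \<in> kspan S k X"
    and 2: "v \<in> kspan S k X \<Longrightarrow> ip H (residual X f) v = 0"
    using theI'[OF projection_ex1[OF assms]]
    by (auto simp: residual_def interpolant_eq_hproj[OF assms] hproj_def)
  show "residual X f \<in> funs H"
    unfolding residual_def using 1 X f kspan_funs by (intro funs_diff) auto
qed

lemma power_fun_eq:
  assumes "finite X" "X \<subseteq> S" "z \<in> S"
  shows "power_fun S k H X z = hnorm H (residual X (ksec S k z))"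
  using assms by (simp add: power_fun_def residual_def interpolant_eq_hproj)

text \<open>\<open>interpolant S k X g\<close> lies in the span belonging to the larger set
  \<open>Y\<close>, to which \<open>residual Y f\<close> is orthogonal. The power function estimates
  and the Newton coefficients rest on this exchange.\<close>

lemma ip_residual_right:
  assumes "finite Y" "Y \<subseteq> S" "X \<subseteq> Y" "f \<in> funs H" "g \<in> funs H"
  shows "ip H (residual Y f) (residual X g) = ip H (residual Y f) g"
proof -
  have X: "finite X" "X \<subseteq> S" using assms finite_subset by auto
  have i: "interpolant S k X g \<in> kspan S k Y"
    using interpolant_kspan[OF X] kspan_mono assms by blast
  then have "ip H (residual Y f) (residual X g) = ip H (residual Y f) g - ip H (residual Y f) (interpolant S k X g)"
    unfolding residual_def[of X]
    using assms residual_funs kspan_funs by (intro ip_diff_right) auto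
  then show ?thesis using i residual_orthogonal assms by auto
qed

lemma residual_vanishes: "finite X \<Longrightarrow> X \<subseteq> S \<Longrightarrow> f \<in> funs H \<Longrightarrow> x \<in> X \<Longrightarrow> residual X f x = 0"
  using orthogonal_kspan_iff[of X "residual X f"] residual_orthogonal[of X f] residual_funs[of X f] by blast

lemma hnorm_residual_antimono:
  assumes "finite Y" "Y \<subseteq> S" "X \<subseteq> Y" "f \<in> funs H"
  shows "hnorm H (residual Y f) \<le> hnorm H (residual X f)"
proof -
  have r: "residual Y f \<in> funs H" "residual X f \<in> funs H"
    using assms residual_funs finite_subset[of X Y] by auto
  have "(hnorm H (residual Y f))\<^sup>2 = ip H (residual Y f) (residual X f)"
    using assms r by (simp add: hnorm_power2 ip_residual_right)
  also have "\<dots> \<le> hnorm H (residual Y f) * hnorm H (residual X f)"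
    using abs_ip_le[OF r] by simp
  finally show ?thesis
    using r by (cases "hnorm H (residual Y f) = 0") (auto simp: power2_eq_square less_le)
qed

text \<open>The reproducing property and \<open>ip_residual_right\<close> write the point value as
  an inner product of two residuals, to which Cauchy-Schwarz applies.\<close>

lemma abs_residual_le:
  assumes "finite X" "X \<subseteq> S" "f \<in> funs H" "z \<in> S"
  shows "\<bar>residual X f z\<bar> \<le> hnorm H (residual X f) * power_fun S k H X z"
proof -
  have "residual X f z = ip H (residual X f) (residual X (ksec S k z))"
    using assms by (simp add: ip_residual_right reproducing residual_funs)
  then show ?thesis using assms by (simp add: power_fun_eq abs_ip_le residual_funs)
qed

lemma power_fun_le:
  assumes "finite X" "X \<subseteq> S" "z \<in> S"
  shows "power_fun S k H X z \<le> sqrt (k z z)"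
proof -
  have "residual {} g = g" for g
    by (auto simp: residual_def interpolant_def kspan_def)
  then have "power_fun S k H X z \<le> hnorm H (ksec S k z)"
    using hnorm_residual_antimono[of X "{}" "ksec S k z"] assms by (simp add: power_fun_eq)
  also have "\<dots> = sqrt (k z z)"
    using assms by (simp add: hnorm_def reproducing) (simp add: ksec_def)
  finally show ?thesis .
qed

text \<open>As \<open>z\<close> is not in \<open>X\<close>, the residual of \<open>k(.,z)\<close> is
  a combination of sections with coefficient 1 at \<open>z\<close>. Its squared norm is thus a
  nontrivial quadratic form of the kernel.\<close>

lemma power_fun_pos:
  assumes X: "finite X" "X \<subseteq> S" and z: "z \<in> S - X"
  shows "0 < power_fun S k H X z"
proof -
  let ?w = "residual X (ksec S k z)"
  obtain c where c: "interpolant S k X (ksec S k z) = (\<lambda>y. \<Sum>x\<in>X. c x * ksec S k x y)"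
    using interpolant_kspan[OF X, of "ksec S k z"] z unfolding kspan_def by auto
  define c' where "c' = (\<lambda>x. if x = z then 1 else - c x)"
  let ?Z = "insert z X"
  have w: "?w = (\<lambda>y. \<Sum>x\<in>?Z. c' x * ksec S k x y)"
  proof
    fix y
    have "(\<Sum>x\<in>X. c' x * ksec S k x y) = - (\<Sum>x\<in>X. c x * ksec S k x y)"
      unfolding sum_negf[symmetric] using z by (intro sum.cong) (auto simp: c'_def)
    then show "?w y = (\<Sum>x\<in>?Z. c' x * ksec S k x y)"
      using X z by (simp add: residual_def c) (simp add: c'_def)
  qed
  have f: "ksec S k x \<in> funs H" if "x \<in> ?Z" for x using that X z by auto
  have "0 < (\<Sum>x\<in>?Z. \<Sum>y\<in>?Z. c' x * c' y * k x y)"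
  proof -
    have "finite ?Z" "?Z \<subseteq> S" "\<exists>x\<in>?Z. c' x \<noteq> 0" using X z by (auto simp: c'_def)
    then show ?thesis using spd unfolding strictly_pos_def_on_def by blast
  qed
  also have "\<dots> = ip H ?w ?w"
  proof -
    have kk: "ip H (ksec S k x) (ksec S k y) = k x y" if "x \<in> ?Z" "y \<in> ?Z" for x y
    proof -
      have S: "x \<in> S" "y \<in> S" using that X z by auto
      then have "ip H (ksec S k x) (ksec S k y) = k y x"
        by (simp add: reproducing) (simp add: ksec_def)
      then show ?thesis using spd S by (simp add: strictly_pos_def_on_def)
    qed
    have "?w \<in> funs H" using X z by (intro residual_funs) auto
    then have "ip H ?w ?w = (\<Sum>x\<in>?Z. c' x * ip H (ksec S k x) ?w)"
      by (subst (1) w) (intro ip_sum_left f)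
    also have "\<dots> = (\<Sum>x\<in>?Z. c' x * (\<Sum>y\<in>?Z. c' y * k x y))"
    proof (intro sum.cong refl)
      fix x assume x: "x \<in> ?Z"
      have "ip H (ksec S k x) ?w = (\<Sum>y\<in>?Z. c' y * ip H (ksec S k x) (ksec S k y))"
        unfolding w using f x by (intro ip_sum_right) auto
      also have "\<dots> = (\<Sum>y\<in>?Z. c' y * k x y)"
        using x by (intro sum.cong refl) (simp only: kk)
      finally show "c' x * ip H (ksec S k x) ?w = c' x * (\<Sum>y\<in>?Z. c' y * k x y)" by simp
    qed
    finally have "ip H ?w ?w = (\<Sum>x\<in>?Z. c' x * (\<Sum>y\<in>?Z. c' y * k x y))" .
    then show ?thesis by (simp only: sum_distrib_left mult.assoc)
  qed
  finally show ?thesis using X z by (simp add: power_fun_eq hnorm_def)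
qed

lemma residual_power_fun_bounds:
  assumes "finite X" "f \<in> funs H" "hnorm H (residual X f) \<le> N" "X \<subseteq> S" "z \<in> S - X"
    and "\<And>y. y \<in> S \<Longrightarrow> k y y \<le> 1"
  shows "\<bar>residual X f z\<bar> \<le> N * power_fun S k H X z" "0 < power_fun S k H X z" "power_fun S k H X z \<le> 1"
proof -
  show p: "0 < power_fun S k H X z" using assms by (intro power_fun_pos) auto
  have "\<bar>residual X f z\<bar> \<le> hnorm H (residual X f) * power_fun S k H X z"
    using assms by (intro abs_residual_le) auto
  also have "\<dots> \<le> N * power_fun S k H X z"
    using assms p by (intro mult_right_mono) auto
  finally show "\<bar>residual X f z\<bar> \<le> N * power_fun S k H X z" .
  have "power_fun S k H X z \<le> sqrt (k z z)" using assms by (intro power_fun_le) auto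
  also have "\<dots> \<le> 1" using assms by auto
  finally show "power_fun S k H X z \<le> 1" .
qed

text \<open>Shows that the infimum in \<open>entropy_number\<close> runs over a nonempty set: the
  radius 1 belongs to it. Closedness of the ball carries the bound from finite combinations to their
  closure.\<close>

lemma abs_conv_hull_subset_mcball:
  assumes "\<And>y. y \<in> S \<Longrightarrow> k y y \<le> 1"
  shows "abs_conv_hull H (ksec S k ` S) \<subseteq> Metric_space.mcball (funs H) (hdist H) (\<lambda>x. 0) 1"
proof -
  interpret MS: Metric_space "funs H" "hdist H"
    using inner_fun_space by (rule Metric_space_hdist)
  have z: "hdist H (\<lambda>x. 0) v = hnorm H v" if "v \<in> funs H" for v
    using that MS.commute[of "\<lambda>x. 0" v] by (simp add: hdist_def fun_diff_def)
  have K: "g \<in> funs H" "hnorm H g \<le> 1" if g: "g \<in> ksec S k ` S" for g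
  proof -
    obtain y where y: "y \<in> S" "g = ksec S k y" using g by blast
    have "hnorm H g = sqrt (k y y)"
      using y by (simp add: hnorm_def reproducing) (simp add: ksec_def)
    then show "g \<in> funs H" "hnorm H g \<le> 1" using y assms by auto
  qed
  have "hnorm H (\<lambda>y. \<Sum>i<m. c i * g i y) \<le> 1 \<and> (\<lambda>y. \<Sum>i<m. c i * g i y) \<in> funs H"
    if g: "\<forall>i<m. g i \<in> ksec S k ` S" and c: "(\<Sum>i<m. \<bar>c i\<bar>) \<le> 1" for m :: nat and c g
  proof -
    define v where "v = (\<lambda>y. \<Sum>i<m. c i * g i y)"
    have v: "v \<in> funs H" unfolding v_def using g K by (intro funs_sum) auto
    \<comment> \<open>Pairing \<open>v\<close> with its own expansion bounds the squared norm by the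
      norm itself.\<close>
    have "(hnorm H v)\<^sup>2 = (\<Sum>i<m. c i * ip H v (g i))"
    proof -
      have "ip H u v = (\<Sum>i<m. c i * ip H u (g i))" if "u \<in> funs H" for u
        unfolding v_def using that g K by (intro ip_sum_right) auto
      then show ?thesis using v by (simp add: hnorm_power2)
    qed
    also have "\<dots> \<le> (\<Sum>i<m. \<bar>c i\<bar> * hnorm H v)"
    proof (intro sum_mono)
      fix i assume i: "i \<in> {..<m}"
      have "c i * ip H v (g i) \<le> \<bar>c i\<bar> * \<bar>ip H v (g i)\<bar>"
        by (metis abs_ge_self abs_mult)
      also have "\<bar>ip H v (g i)\<bar> \<le> hnorm H v * hnorm H (g i)"
        using v g K i by (intro abs_ip_le) auto
      also have "hnorm H v * hnorm H (g i) \<le> hnorm H v * 1"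
        using v g K i by (intro mult_left_mono) auto
      finally show "c i * ip H v (g i) \<le> \<bar>c i\<bar> * hnorm H v" by (simp add: mult_left_mono)
    qed
    also have "\<dots> \<le> 1 * hnorm H v"
      unfolding sum_distrib_right[symmetric] using c v by (intro mult_right_mono) auto
    finally have "hnorm H v \<le> 1"
      using v hnorm_nonneg[OF v] by (cases "hnorm H v = 0") (auto simp: power2_eq_square)
    with v show ?thesis by (simp add: v_def)
  qed
  then show ?thesis
    unfolding abs_conv_hull_def by (intro closure_of_minimal MS.closedin_mcball) (auto simp: z)
qed

end

section \<open>The Newton basis and entropy numbers\<close>

text \<open>Counting starts at \<open>x 1\<close>: \<open>sel x 0\<close> is empty, and step
  \<open>i\<close> adds \<open>x (Suc i)\<close> to the \<open>i\<close> points of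
  \<open>sel x i\<close>.\<close>

locale point_sequence = rkhs S k H for S :: "'a set" and k H +
  fixes x :: "nat \<Rightarrow> 'a"
  assumes point_new: "x (Suc i) \<in> S - sel x i"
begin

lemma finite_sel [simp]: "finite (sel x i)"
  and sel_mono: "i \<le> j \<Longrightarrow> sel x i \<subseteq> sel x j"
  and point_in_sel: "i < j \<Longrightarrow> x (Suc i) \<in> sel x j"
  by (auto simp: sel_def)

lemma point_in [simp]: "x (Suc i) \<in> S"
  using point_new by auto

lemma sel_subset [simp]: "sel x i \<subseteq> S"
proof
  fix y assume "y \<in> sel x i"
  then obtain j where "y = x j" "1 \<le> j" by (auto simp: sel_def)
  then show "y \<in> S" using point_in[of "j - 1"] by simp
qed

definition pw :: "nat \<Rightarrow> real" where
  "pw i = power_fun S k H (sel x i) (x (Suc i))"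

definition newton :: "nat \<Rightarrow> 'a \<Rightarrow> real" where
  "newton i = (\<lambda>y. inverse (pw i) * residual (sel x i) (ksec S k (x (Suc i))) y)"

lemma pw_pos: "0 < pw i"
  unfolding pw_def using point_new by (intro power_fun_pos) auto

lemma newton_funs [simp]: "newton i \<in> funs H"
  unfolding newton_def by (intro funs_scale residual_funs) auto

lemma ip_newton: "g \<in> funs H \<Longrightarrow>
    ip H g (newton i) = ip H (residual (sel x i) (ksec S k (x (Suc i)))) g / pw i"
  unfolding newton_def
  by (simp add: ip_scale_right residual_funs ip_commute[of g] divide_inverse mult.commute)

lemma ip_kspan_newton: "v \<in> kspan S k (sel x i) \<Longrightarrow> ip H v (newton i) = 0"
  using kspan_funs[of "sel x i" v] by (simp add: ip_newton residual_orthogonal)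

text \<open>The vanishing half of the triangular coefficient matrix; \<open>ip_ksec_newton\<close>
  supplies its diagonal.\<close>

lemma ip_ksec_newton_0: "i < j \<Longrightarrow> ip H (ksec S k (x (Suc i))) (newton j) = 0"
  by (intro ip_kspan_newton ksec_in_kspan point_in_sel) auto

lemma ip_ksec_newton: "ip H (ksec S k (x (Suc i))) (newton i) = pw i"
proof -
  let ?w = "residual (sel x i) (ksec S k (x (Suc i)))"
  have "ip H ?w (ksec S k (x (Suc i))) = ip H ?w ?w"
    by (simp add: ip_residual_right)
  also have "\<dots> = (pw i)\<^sup>2"
    by (simp add: pw_def power_fun_eq hnorm_power2 residual_funs)
  finally show ?thesis using pw_pos[of i] by (simp add: ip_newton power2_eq_square)
qed

text \<open>For \<open>i < j\<close> the function \<open>newton i\<close> lies in the span belonging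
  to \<open>sel x j\<close>, to which \<open>newton j\<close> is orthogonal.\<close>

lemma newton_orthonormal: "ip H (newton i) (newton j) = (if i = j then 1 else 0)"
proof -
  have less: "ip H (newton i) (newton j) = 0" if "i < j" for i j
  proof -
    have "interpolant S k (sel x i) (ksec S k (x (Suc i))) \<in> kspan S k (sel x i)"
      by (intro interpolant_kspan) auto
    then have "residual (sel x i) (ksec S k (x (Suc i))) \<in> kspan S k (sel x j)"
      unfolding residual_def using that kspan_mono[of "sel x j" "sel x i"] sel_mono[of i j]
      by (intro kspan_diff ksec_in_kspan point_in_sel) auto
    then show ?thesis
      by (subst newton_def) (simp add: ip_scale_left residual_funs ip_kspan_newton)
  qed
  have "ip H (newton i) (newton i) = ip H (residual (sel x i) (ksec S k (x (Suc i)))) (newton i) / pw i" for i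
    by (subst newton_def) (simp add: ip_scale_left residual_funs divide_inverse mult.commute)
  also have "\<dots> i = 1" for i
  proof -
    have "ip H (residual (sel x i) (ksec S k (x (Suc i)))) (newton i) = pw i"
      using ip_residual_right[of "sel x i" "sel x i" "ksec S k (x (Suc i))" "ksec S k (x (Suc i))"]
        ip_ksec_newton[of i] by (simp add: ip_newton residual_funs)
    then show ?thesis using pw_pos[of i] by simp
  qed
  finally show ?thesis
    using less[of i j] less[of j i] ip_commute[of "newton i" "newton j"] by (cases i j rule: linorder_cases) auto
qed

text \<open>The residual \<open>?w\<close> is orthogonal to everything spanned by
  \<open>sel x i\<close>, so passing from \<open>residual (sel x m) f\<close> to
  \<open>residual (sel x i) f\<close> leaves the coefficient unchanged. All later steps can
  therefore be read off one function.\<close>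

lemma ip_residual_newton:
  assumes "f \<in> funs H" "m \<le> i"
  shows "ip H (residual (sel x m) f) (newton i) = residual (sel x i) f (x (Suc i)) / pw i"
proof -
  let ?w = "residual (sel x i) (ksec S k (x (Suc i)))"
  have r: "residual (sel x j) f \<in> funs H" for j using assms by (intro residual_funs) auto
  have w: "?w \<in> funs H" by (intro residual_funs) auto
  have "ip H ?w (residual (sel x m) f) = ip H ?w f"
    using assms sel_mono by (intro ip_residual_right) auto
  also have "\<dots> = ip H ?w (residual (sel x i) f)"
    using assms by (intro ip_residual_right[symmetric]) auto
  also have "\<dots> = ip H (residual (sel x i) f) ?w"
    using r w by (intro ip_commute)
  also have "\<dots> = ip H (residual (sel x i) f) (ksec S k (x (Suc i)))"
    using assms by (intro ip_residual_right) auto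
  also have "\<dots> = residual (sel x i) f (x (Suc i))" using r by (simp add: reproducing)
  finally show ?thesis using r by (simp add: ip_newton)
qed

lemma sum_newton_coefficients_le:
  assumes "f \<in> funs H" "finite A" "\<And>i. i \<in> A \<Longrightarrow> m \<le> i"
  shows "(\<Sum>i\<in>A. (\<bar>residual (sel x i) f (x (Suc i))\<bar> / pw i)\<^sup>2) \<le> (hnorm H (residual (sel x m) f))\<^sup>2"
proof -
  have r: "residual (sel x m) f \<in> funs H" using assms by (intro residual_funs) auto
  have "(\<Sum>i\<in>A. (\<bar>residual (sel x i) f (x (Suc i))\<bar> / pw i)\<^sup>2) =
      (\<Sum>i\<in>A. (ip H (residual (sel x m) f) (newton i))\<^sup>2)"
    using assms by (intro sum.cong) (auto simp: ip_residual_newton power_divide)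
  also have "\<dots> \<le> ip H (residual (sel x m) f) (residual (sel x m) f)"
    using assms r by (intro bessel) (auto simp: newton_orthonormal)
  finally show ?thesis using r by (simp add: hnorm_power2)
qed

section \<open>Products of power function values and entropy numbers\<close>

text \<open>By Bessel's inequality, taking the Newton coefficients with index in \<open>A\<close>
  does not increase distances, so a covering of the hull becomes one in coefficient space.
  \<open>A\<close> may be any finite nonempty set of steps.\<close>

lemma prod_pw_le_of_covering:
  assumes A: "finite A" "A \<noteq> {}" and e: "0 < e"
    and C: "C \<subseteq> funs H" "finite C" "card C \<le> 2 ^ card A"
    and cov: "abs_conv_hull H (ksec S k ` S) \<subseteq> (\<Union>c\<in>C. Metric_space.mcball (funs H) (hdist H) c e)"
  shows "(\<Prod>i\<in>A. pw i) \<le> (sqrt (5 * card A) * e) ^ card A"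
proof -
  interpret MS: Metric_space "funs H" "hdist H"
    using inner_fun_space by (rule Metric_space_hdist)
  define a where "a = (\<lambda>i j. ip H (ksec S k (x (Suc i))) (newton j))"
  let ?coeffs = "\<lambda>g j. ip H g (newton j)"
  have "(\<Prod>i\<in>A. a i i) \<le> fact (card A) * unit_ball_vol (card A) * e ^ card A"
  proof (rule prod_diag_le_of_covering[of A a "?coeffs ` C", OF A(1) _ _ _ _ e])
    fix c :: "nat \<Rightarrow> real" assume c: "(\<Sum>i\<in>A. \<bar>c i\<bar>) \<le> 1"
    define v where "v = (\<lambda>y. \<Sum>i\<in>A. c i * ksec S k (x (Suc i)) y)"
    have v: "v \<in> funs H" unfolding v_def by (intro funs_sum) auto
    \<comment> \<open>The hull is defined with sums over \<open>{..<m}\<close>; \<open>h\<close>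
      renumbers \<open>A\<close> accordingly.\<close>
    obtain h where h: "bij_betw h {..<card A} A"
      using ex_bij_betw_nat_finite[OF A(1)] by (auto simp: atLeast0LessThan)
    have v_eq: "v = (\<lambda>y. \<Sum>i<card A. c (h i) * ksec S k (x (Suc (h i))) y)"
      unfolding v_def by (rule ext) (rule sum.reindex_bij_betw[OF h, symmetric])
    have sum_h: "(\<Sum>i<card A. \<bar>c (h i)\<bar>) \<le> 1"
      using c sum.reindex_bij_betw[OF h, of "\<lambda>i. \<bar>c i\<bar>"] by simp
    let ?D = "{(\<lambda>y. \<Sum>i<m. c i * g i y) | (m::nat) c g. (\<forall>i<m. g i \<in> ksec S k ` S) \<and> (\<Sum>i<m. \<bar>c i\<bar>) \<le> 1}"
    have "v \<in> ?D"
      unfolding v_eq using sum_h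
      by (intro CollectI exI[of _ "card A"] exI[of _ "\<lambda>i. c (h i)"] exI[of _ "\<lambda>i. ksec S k (x (Suc (h i)))"]) auto
    moreover have "?D \<subseteq> topspace MS.mtopology"
      by (auto intro!: funs_sum)
    ultimately have "v \<in> abs_conv_hull H (ksec S k ` S)"
      unfolding abs_conv_hull_def using closure_of_subset by blast
    then obtain g where g: "g \<in> C" "hdist H g v \<le> e" using cov by auto
    then have gf: "g \<in> funs H" using C by auto
    have hn: "hnorm H (v - g) \<le> e"
      using g gf v MS.commute[of g v] by (simp add: hdist_def)
    have "(\<Sum>j\<in>A. ((\<Sum>i\<in>A. c i * a i j) - ?coeffs g j)\<^sup>2) = (\<Sum>j\<in>A. (ip H (v - g) (newton j))\<^sup>2)"
    proof (intro sum.cong refl)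
      fix j
      have "ip H v (newton j) = (\<Sum>i\<in>A. c i * a i j)"
        unfolding v_def a_def by (intro ip_sum_left) auto
      then show "((\<Sum>i\<in>A. c i * a i j) - ?coeffs g j)\<^sup>2 = (ip H (v - g) (newton j))\<^sup>2"
        using v gf by (simp add: ip_diff_left)
    qed
    also have "\<dots> \<le> ip H (v - g) (v - g)"
      using A v gf by (intro bessel) (auto simp: newton_orthonormal funs_diff)
    finally have "sqrt (\<Sum>j\<in>A. ((\<Sum>i\<in>A. c i * a i j) - ?coeffs g j)\<^sup>2) \<le> hnorm H (v - g)"
      by (simp add: hnorm_def)
    with hn have "sqrt (\<Sum>j\<in>A. ((\<Sum>i\<in>A. c i * a i j) - ?coeffs g j)\<^sup>2) \<le> e" by linarith
    then show "\<exists>y\<in>?coeffs ` C. sqrt (\<Sum>j\<in>A. ((\<Sum>i\<in>A. c i * a i j) - y j)\<^sup>2) \<le> e"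
      using g(1) by (intro bexI[of _ "?coeffs g"]) auto
  qed (use C in \<open>auto simp: a_def ip_ksec_newton ip_ksec_newton_0 pw_pos intro: order_trans[OF card_image_le]\<close>)
  also have "fact (card A) * unit_ball_vol (card A) \<le> sqrt (5 * card A) ^ card A"
  proof (rule power2_le_imp_le)
    have "(fact (card A) * unit_ball_vol (card A))\<^sup>2 \<le> (5 * real (card A)) ^ card A"
      using A by (intro fact_unit_ball_vol_le) (simp add: Suc_le_eq card_gt_0_iff)
    also have "\<dots> = ((sqrt (5 * card A))\<^sup>2) ^ card A" by simp
    also have "\<dots> = (sqrt (5 * card A) ^ card A)\<^sup>2"
      by (metis power_mult mult.commute)
    finally show "(fact (card A) * unit_ball_vol (card A))\<^sup>2 \<le> (sqrt (5 * card A) ^ card A)\<^sup>2" .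
  qed simp
  finally show ?thesis
    using e by (simp add: a_def ip_ksec_newton power_mult_distrib mult_right_mono)
qed

lemma prod_pw_le_entropy_number:
  assumes A: "finite A" "A \<noteq> {}" and k1: "\<And>y. y \<in> S \<Longrightarrow> k y y \<le> 1"
  defines "\<epsilon> \<equiv> entropy_number H (abs_conv_hull H (ksec S k ` S)) (card A)"
  shows "0 \<le> \<epsilon>" "(\<Prod>i\<in>A. pw i) \<le> (sqrt (5 * card A) * \<epsilon>) ^ card A"
proof -
  let ?E = "{e. 0 < e \<and> (\<exists>C. C \<subseteq> funs H \<and> finite C \<and> card C \<le> 2 ^ card A \<and>
      abs_conv_hull H (ksec S k ` S) \<subseteq> (\<Union>c\<in>C. Metric_space.mcball (funs H) (hdist H) c e))}"
  have \<epsilon>: "\<epsilon> = Inf ?E" by (simp add: \<epsilon>_def entropy_number_def)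
  have "1 \<in> ?E"
    using abs_conv_hull_subset_mcball[OF k1] by (auto intro!: exI[of _ "{\<lambda>x. 0}"])
  then have ne: "?E \<noteq> {}" by blast
  show "0 \<le> \<epsilon>" unfolding \<epsilon> using ne by (intro cInf_greatest) auto
  let ?p = "\<Prod>i\<in>A. pw i"
  have c: "card A > 0" using A by (simp add: card_gt_0_iff)
  have p: "?p > 0" using pw_pos by (intro prod_pos) auto
  \<comment> \<open>Solving the covering bound for \<open>e\<close> gives a lower bound for all
    admissible radii, which passes to their infimum whether or not it is attained.\<close>
  have "root (card A) ?p / sqrt (5 * card A) \<le> e" if e: "e \<in> ?E" for e
  proof -
    have "root (card A) ?p \<le> root (card A) ((sqrt (5 * card A) * e) ^ card A)"
      using e c prod_pw_le_of_covering[OF A] by (intro real_root_le_mono) auto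
    also have "\<dots> = sqrt (5 * card A) * e" using e c by (intro real_root_power_cancel) auto
    finally show ?thesis using c by (simp add: field_simps)
  qed
  then have "root (card A) ?p / sqrt (5 * card A) \<le> \<epsilon>"
    unfolding \<epsilon> using ne by (intro cInf_greatest) auto
  then have "root (card A) ?p \<le> sqrt (5 * card A) * \<epsilon>" using c by (simp add: field_simps)
  then have "root (card A) ?p ^ card A \<le> (sqrt (5 * card A) * \<epsilon>) ^ card A"
    using p by (intro power_mono real_root_ge_zero) auto
  then show "?p \<le> (sqrt (5 * card A) * \<epsilon>) ^ card A" using p c by simp
qed

end

section \<open>Greedy selection\<close>

locale greedy_run = point_sequence S k H x for S :: "'a set" and k H x +
  fixes \<beta> :: ennreal and \<gamma> :: real and f :: "'a \<Rightarrow> real"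
  assumes greedy: "weak_greedy S k H \<beta> \<gamma> f x"
    and f: "f \<in> funs H" and \<gamma>: "0 < \<gamma>" and k1: "\<And>y. y \<in> S \<Longrightarrow> k y y \<le> 1"
begin

abbreviation "\<rho> i \<equiv> residual (sel x i) f"

lemma hnorm_\<rho>_le: "m \<le> i \<Longrightarrow> hnorm H (\<rho> i) \<le> hnorm H (\<rho> m)"
  using f sel_mono by (intro hnorm_residual_antimono) auto

lemma \<rho>_bounds:
  assumes "m \<le> i" "z \<in> S - sel x i"
  shows "\<bar>\<rho> i z\<bar> \<le> hnorm H (\<rho> m) * power_fun S k H (sel x i) z"
    "0 < power_fun S k H (sel x i) z" "power_fun S k H (sel x i) z \<le> 1"
  using residual_power_fun_bounds[of "sel x i" f "hnorm H (\<rho> m)" z] assms f k1 hnorm_\<rho>_le by auto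

lemma \<rho>_zero: "z \<in> sel x i \<Longrightarrow> \<rho> i z = 0"
  using f by (intro residual_vanishes) auto

lemma le_inverse_mult: "\<gamma> * s \<le> t \<Longrightarrow> s \<le> inverse \<gamma> * t"
  using \<gamma> by (simp add: field_simps)

lemma S_ne: "S \<noteq> {}"
  using point_in[of 0] by blast

lemma eta_le_next:
  assumes "z \<in> S - sel x i"
  shows "\<gamma> * eta S k H \<beta> f (sel x i) z \<le> eta S k H \<beta> f (sel x i) (x (Suc i))"
proof -
  let ?N = "hnorm H (\<rho> i)"
  \<comment> \<open>This bound makes the set under the supremum bounded above, without which the
    supremum would not dominate its members.\<close>
  have "eta S k H \<beta> f (sel x i) z \<le> (if \<beta> = \<infinity> then ?N else rpow ?N (enn2real \<beta>))"
    if "z \<in> S - sel x i" for z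
    using \<rho>_bounds[OF order_refl that] unfolding eta_def residual_def[symmetric]
    by (auto intro: rpow_eta_le simp: field_simps)
  then have "bdd_above (eta S k H \<beta> f (sel x i) ` (S - sel x i))"
    by (auto intro!: bdd_aboveI)
  then have "eta S k H \<beta> f (sel x i) z \<le> (SUP z\<in>S - sel x i. eta S k H \<beta> f (sel x i) z)"
    using assms by (intro cSUP_upper)
  then have "\<gamma> * eta S k H \<beta> f (sel x i) z \<le> \<gamma> * (SUP z\<in>S - sel x i. eta S k H \<beta> f (sel x i) z)"
    using \<gamma> by (intro mult_left_mono) auto
  also have "\<dots> \<le> eta S k H \<beta> f (sel x i) (x (Suc i))"
    using greedy by (simp add: weak_greedy_def)
  finally show ?thesis .
qed

text \<open>The greedy condition says nothing about points already selected; there the residual is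
  zero, so \<open>0 \<le> D\<close> suffices.\<close>

lemma sup_norm_\<rho>_leI:
  assumes "0 \<le> D" "\<And>z. z \<in> S - sel x i \<Longrightarrow> \<bar>\<rho> i z\<bar> \<le> D"
  shows "sup_norm S (\<rho> i) \<le> D"
  unfolding sup_norm_def
proof (intro cSUP_least S_ne)
  fix z assume "z \<in> S"
  then show "\<bar>\<rho> i z\<bar> \<le> D" using assms \<rho>_zero by (cases "z \<in> sel x i") auto
qed

lemma sup_norm_\<rho>_le: "m \<le> i \<Longrightarrow> sup_norm S (\<rho> i) \<le> hnorm H (\<rho> m)"
proof (intro sup_norm_\<rho>_leI)
  assume "m \<le> i"
  show "0 \<le> hnorm H (\<rho> m)" using f by (intro hnorm_nonneg residual_funs) auto
  fix z assume "z \<in> S - sel x i"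
  note bd = \<rho>_bounds[OF \<open>m \<le> i\<close> this]
  note bd(1)
  also have "hnorm H (\<rho> m) * power_fun S k H (sel x i) z \<le> hnorm H (\<rho> m)"
    using bd \<open>0 \<le> hnorm H (\<rho> m)\<close> by (intro mult_left_le) auto
  finally show "\<bar>\<rho> i z\<bar> \<le> hnorm H (\<rho> m)" .
qed

text \<open>Chains \<open>powr_le_rpow_eta\<close> at an arbitrary point, the greedy condition, and
  \<open>rpow_eta_eq\<close> at the selected point. The norm is taken at the fixed index
  \<open>m\<close> to serve all steps \<open>i\<close> alike.\<close>

lemma step_finite:
  assumes "\<beta> \<noteq> \<infinity>" "m \<le> i" "0 < M" "M \<le> sup_norm S (\<rho> i)"
  defines "b \<equiv> enn2real \<beta>"
  shows "\<gamma> * M powr max 1 b \<le>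
    rpow (\<bar>\<rho> i (x (Suc i))\<bar> / pw i) b * pw i * hnorm H (\<rho> m) powr (max 1 b - b)"
proof -
  let ?N = "hnorm H (\<rho> m)" and ?B = "max 1 b"
  have N: "0 < ?N" using assms sup_norm_\<rho>_le[of m i] by linarith
  have b: "0 \<le> b" and B: "?B \<noteq> 0" by (simp_all add: b_def)
  define D where "D = inverse \<gamma> * (rpow (\<bar>\<rho> i (x (Suc i))\<bar> / pw i) b * pw i * ?N powr (?B - b))"
  have D: "0 \<le> D" using \<gamma> pw_pos[of i] by (auto simp: D_def intro!: mult_nonneg_nonneg less_imp_le)
  \<comment> \<open>The supremum is over the residual itself, so the pointwise bound on its power
    \<open>?B\<close> is first turned into one by a root.\<close>
  have "sup_norm S (\<rho> i) \<le> D powr (1 / ?B)"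
  proof (intro sup_norm_\<rho>_leI)
    fix z assume z: "z \<in> S - sel x i"
    note bd = \<rho>_bounds[OF \<open>m \<le> i\<close> z]
    have eta: "eta S k H \<beta> f (sel x i) z =
        rpow \<bar>\<rho> i z\<bar> b * rpow (power_fun S k H (sel x i) z) (1 - b)" for z
      using assms(1) by (simp only: eta_def residual_def b_def if_False)
    have "eta S k H \<beta> f (sel x i) (x (Suc i)) = rpow (\<bar>\<rho> i (x (Suc i))\<bar> / pw i) b * pw i"
      using pw_pos[of i] unfolding eta pw_def by (intro rpow_eta_eq) auto
    then have "eta S k H \<beta> f (sel x i) z \<le> inverse \<gamma> * (rpow (\<bar>\<rho> i (x (Suc i))\<bar> / pw i) b * pw i)"
      using le_inverse_mult[OF eta_le_next[OF z]] by simp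
    then have "eta S k H \<beta> f (sel x i) z * ?N powr (?B - b) \<le> D"
      unfolding D_def mult.assoc[symmetric] by (intro mult_right_mono) (auto simp: mult.assoc)
    moreover have "\<bar>\<rho> i z\<bar> powr ?B \<le> eta S k H \<beta> f (sel x i) z * ?N powr (?B - b)"
      unfolding eta using bd N b by (intro powr_le_rpow_eta) auto
    ultimately have "\<bar>\<rho> i z\<bar> powr ?B \<le> D" by linarith
    then have "(\<bar>\<rho> i z\<bar> powr ?B) powr (1 / ?B) \<le> D powr (1 / ?B)"
      by (intro powr_mono2) auto
    then show "\<bar>\<rho> i z\<bar> \<le> D powr (1 / ?B)" using B by (simp add: powr_powr)
  qed simp
  with assms have "M \<le> D powr (1 / ?B)" by linarith
  then have "M powr ?B \<le> (D powr (1 / ?B)) powr ?B" using assms by (intro powr_mono2) auto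
  also have "\<dots> = D" using D B by (simp add: powr_powr)
  finally show ?thesis using \<gamma> by (simp add: D_def field_simps)
qed

text \<open>Dividing by a power function value that is at most 1 only enlarges the residual. No
  factor \<open>pw i\<close> remains, so the entropy numbers do not enter for
  \<open>\<beta> = \<infinity>\<close>.\<close>

lemma step_infinite:
  assumes "\<beta> = \<infinity>" "M \<le> sup_norm S (\<rho> i)"
  shows "\<gamma> * M \<le> \<bar>\<rho> i (x (Suc i))\<bar> / pw i"
proof -
  let ?q = "\<bar>\<rho> i (x (Suc i))\<bar> / pw i"
  have "sup_norm S (\<rho> i) \<le> inverse \<gamma> * ?q"
  proof (intro sup_norm_\<rho>_leI)
    fix z assume z: "z \<in> S - sel x i"
    note bd = \<rho>_bounds[OF order_refl z]
    have eta: "eta S k H \<beta> f (sel x i) z = \<bar>\<rho> i z\<bar> / power_fun S k H (sel x i) z" for z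
      by (simp only: eta_def residual_def assms(1) simp_thms if_True)
    have "\<bar>\<rho> i z\<bar> \<le> \<bar>\<rho> i z\<bar> / power_fun S k H (sel x i) z"
      using bd mult_left_le[of "power_fun S k H (sel x i) z" "\<bar>\<rho> i z\<bar>"]
      by (simp add: field_simps)
    also have "\<dots> \<le> inverse \<gamma> * ?q"
      using le_inverse_mult[OF eta_le_next[OF z]] unfolding eta pw_def[symmetric] .
    finally show "\<bar>\<rho> i z\<bar> \<le> inverse \<gamma> * ?q" .
  qed (use \<gamma> pw_pos[of i] in auto)
  with assms have "M \<le> inverse \<gamma> * ?q" by linarith
  then have "\<gamma> * M \<le> \<gamma> * (inverse \<gamma> * ?q)" using \<gamma> by (intro mult_left_mono) auto
  moreover have "\<gamma> * (inverse \<gamma> * t) = t" for t using \<gamma> by simp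
  ultimately show ?thesis by (simp only:)
qed

lemma min_sup_norm_le:
  assumes n: "1 \<le> n" and \<gamma>1: "\<gamma> \<le> 1"
  shows "Min ((\<lambda>i. sup_norm S (\<rho> i)) ` {n + 1..2 * n})
    \<le> inverse \<gamma> * rate_factor \<beta> n (entropy_number H (abs_conv_hull H (ksec S k ` S)) n)
      * hnorm H (\<rho> (n + 1))" (is "?M \<le> inverse \<gamma> * rate_factor \<beta> n ?\<epsilon> * ?N")
proof (cases "?M \<le> 0")
  \<comment> \<open>The powers below need a positive minimum; otherwise nonnegativity of the
    right-hand side is enough.\<close>
  case True
  have "0 \<le> ?N" using f by (intro hnorm_nonneg residual_funs) auto
  moreover have "0 \<le> rate_factor \<beta> n ?\<epsilon>" by (simp add: rate_factor_def)
  ultimately have "0 \<le> inverse \<gamma> * rate_factor \<beta> n ?\<epsilon> * ?N" using \<gamma> by (intro mult_nonneg_nonneg) auto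
  with True show ?thesis by linarith
next
  case False
  let ?A = "{n + 1..2 * n}" and ?q = "\<lambda>i. \<bar>\<rho> i (x (Suc i))\<bar> / pw i"
  have A: "finite ?A" "?A \<noteq> {}" and card: "card ?A = n" using n by auto
  define M where "M = ?M"
  have M: "0 < M" "\<And>i. i \<in> ?A \<Longrightarrow> M \<le> sup_norm S (\<rho> i)"
    using False by (auto simp: M_def)
  have q: "0 \<le> ?q i" for i using pw_pos[of i] by simp
  \<comment> \<open>The \<open>n\<close> steps in \<open>?A\<close> are orthonormal coefficients of
    the single residual \<open>\<rho> (n + 1)\<close>; its norm is the one in the
    conclusion.\<close>
  have sq: "(\<Sum>i\<in>?A. (?q i)\<^sup>2) \<le> ?N\<^sup>2"
    using f A by (intro sum_newton_coefficients_le) auto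
  \<comment> \<open>A positive lower bound for the sup norm at step \<open>n + 1\<close> forces a
    positive norm.\<close>
  have N: "0 < ?N" 
    using n by (intro less_le_trans[OF M(1) order_trans[OF M(2) sup_norm_\<rho>_le[OF order_refl]]]) auto
  have "M \<le> inverse \<gamma> * rate_factor \<beta> n ?\<epsilon> * ?N"
  proof (cases "\<beta> = \<infinity>")
    case True
    have "(\<gamma> * M) ^ n = (\<Prod>i\<in>?A. \<gamma> * M)" using card by simp
    also have "\<dots> \<le> (\<Prod>i\<in>?A. ?q i)"
      using \<gamma> M step_infinite[OF True] by (intro prod_mono) auto
    also have "\<dots> \<le> (?N / sqrt n) ^ n"
      using prod_le_sum_squares[OF A q _ sq] N card by simp
    finally have "\<gamma> * M \<le> ?N / sqrt n"
      using \<gamma> M N n by (subst (asm) power_mono_iff) auto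
    moreover have "n powr (- 1 / 2) = 1 / sqrt n"
      by (simp add: powr_minus powr_half_sqrt field_simps)
    ultimately show ?thesis
      using le_inverse_mult[of M "?N / sqrt n"] True by (simp add: rate_factor_def mult_ac)
  next
    case fin: False
    have "prod pw ?A \<le> (sqrt (5 * n) * ?\<epsilon>) ^ n" "0 \<le> ?\<epsilon>"
      using prod_pw_le_entropy_number[OF A k1] card by auto
    then show ?thesis
      using geometric_mean_rate[of ?A M ?N \<gamma> "enn2real \<beta>" ?q pw ?\<epsilon>] A M N \<gamma> \<gamma>1 q sq pw_pos card fin
        step_finite[OF fin _ M(1) M(2), of "n + 1"]
      by (simp add: rate_factor_def)
  qed
  then show ?thesis by (simp only: M_def)
qed

end

theorem theorem7:
  fixes \<Omega> :: "(real ^ 'd) set"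
    and k :: "real ^ 'd \<Rightarrow> real ^ 'd \<Rightarrow> real"
    and H Hc :: "(real ^ 'd) fun_space"
    and E :: "(real ^ 'd \<Rightarrow> real) \<Rightarrow> (real ^ 'd \<Rightarrow> real)"
    and \<beta> :: ennreal
    and \<gamma> :: real
    and f :: "real ^ 'd \<Rightarrow> real"
    and x :: "nat \<Rightarrow> real ^ 'd"
    and n :: nat
  assumes "bounded \<Omega>"
    and "cont_spd_kernel \<Omega> k"
    and "\<forall>y\<in>\<Omega>. k y y \<le> 1"
    and "cont_spd_kernel (closure \<Omega>) k"
    and "is_rkhs \<Omega> k H"
    and "is_rkhs (closure \<Omega>) k Hc"
    and "\<forall>g\<in>funs H. E g \<in> funs Hc \<and> (\<forall>y\<in>\<Omega>. E g y = g y) \<and> hnorm Hc (E g) = hnorm H g"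
    and "admissible \<Omega> \<gamma>"
    and "f \<in> funs H"
    and "weak_greedy \<Omega> k H \<beta> \<gamma> f x"
    and "n \<ge> 1"
  shows "Min ((\<lambda>i. sup_norm \<Omega> (f - interpolant \<Omega> k (sel x i) f)) ` {n + 1..2 * n})
           \<le> inverse \<gamma>
             * rate_factor \<beta> n (entropy_number H (abs_conv_hull H (ksec \<Omega> k ` \<Omega>)) n)
             * hnorm H (f - interpolant \<Omega> k (sel x (n + 1)) f)"
proof -
  interpret rkhs \<Omega> k H
    using assms by unfold_locales (auto simp: cont_spd_kernel_def)
  interpret greedy_run \<Omega> k H x \<beta> \<gamma> f
    using assms by unfold_locales (auto simp: weak_greedy_def admissible_def)
  show ?thesis
    using min_sup_norm_le[OF \<open>n \<ge> 1\<close>] assms(8) by (simp add: residual_def admissible_def)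
qed

end
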